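(* Let $\Bbbk$ be a field of characteristic zero and let $f\in\Bbbk[x]$ be a polynomial such that $f(\Bbbk)=\Bbbk$. Consider the surface $X\subseteq\mathbb{A}^3_{\Bbbk}$ given by the equation $f(x)-uv=0$. Then $X$ is flexible and the special automorphism group $\mathrm{SAut}(X)$ acts $m$-transitively on $X_{\mathrm{reg}}$ for every $m\in\mathbb{N}$.
   Context: The field $\Bbbk$ is not assumed algebraically closed; points of $X$ are $\Bbbk$-points, i.e. triples $(x,u,v)\in\Bbbk^3$ with $f(x)=uv$, and $X_{\mathrm{reg}}$ denotes the set of smooth points of $X$. A one-parameter unipotent subgroup of $\mathrm{Aut}(X)$ is the subgroup determined by an effective algebraic action of the additive group $\mathbb{G}_a(\Bbbk)$ on $X$ (over $\Bbbk$). $\mathrm{SAut}(X)$ is the subgroup of $\mathrm{Aut}(X)$ generated by all one-parameter unipotent subgroups. A point $x\in X$ is flexible if the tangent space $T_xX$ is spanned by the tangent vectors at $x$ to the orbits $H.x$ of one-parameter unipotent subgroups $H\subseteq\mathrm{Aut}(X)$. $X$ is flexible if every point of $X_{\mathrm{reg}}$ is flexible. An action of a group $G$ on a set $A$ is $m$-transitive if for any two $m$-tuples $(a_1,\dots,a_m)$, $(b_1,\dots,b_m)$ of pairwise distinct points of $A$ there is $g\in G$ with $g(a_i)=b_i$ for all $i$. *)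

theory Defs
  imports
    "HOL-Analysis.Cartesian_Space"
    "HOL-Computational_Algebra.Polynomial"
    "HOL-Algebra.Group_Action"
    "HOL-Algebra.Generated_Groups"
begin

text \<open>
  An affine variety is represented by its set of \<open>k\<close>-points, a subset of \<open>'k ^ 'n\<close>, and
  morphisms by restrictions of polynomial maps. This loses nothing for the surface
  \<open>f(x) = u v\<close> treated here, for \<open>k\<close> of characteristic zero and \<open>f\<close> nonconstant: polynomials
  over \<open>k\<close> are determined by their values, and a polynomial vanishing at all \<open>k\<close>-points of the
  surface is a multiple of \<open>f(x) - u v\<close>.
\<close>

subsection \<open>Polynomial functions and regular maps\<close>

text \<open>The algebra of functions generated by the coordinate functions in \<open>C\<close> and the constants.\<close>

inductive_set poly_funs :: "('p \<Rightarrow> 'k::comm_ring_1) set \<Rightarrow> ('p \<Rightarrow> 'k) set"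
  for C :: "('p \<Rightarrow> 'k) set" where
  const: "(\<lambda>_. c) \<in> poly_funs C"
| coord: "g \<in> C \<Longrightarrow> g \<in> poly_funs C"
| add: "g \<in> poly_funs C \<Longrightarrow> h \<in> poly_funs C \<Longrightarrow> (\<lambda>p. g p + h p) \<in> poly_funs C"
| mult: "g \<in> poly_funs C \<Longrightarrow> h \<in> poly_funs C \<Longrightarrow> (\<lambda>p. g p * h p) \<in> poly_funs C"

definition coords :: "('k::comm_ring_1 ^ 'n \<Rightarrow> 'k) set" where
  "coords = range (\<lambda>i p. p $ i)"

definition coords_times :: "('k::comm_ring_1 \<times> ('k ^ 'n) \<Rightarrow> 'k) set" where
  "coords_times = insert fst (range (\<lambda>i q. snd q $ i))"

definition regular_on :: "('k::comm_ring_1 ^ 'n) set \<Rightarrow> ('k ^ 'n \<Rightarrow> 'k ^ 'n) \<Rightarrow> bool" where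
  "regular_on X g \<longleftrightarrow>
     (\<exists>G. (\<forall>i. (\<lambda>p. G p $ i) \<in> poly_funs coords) \<and> (\<forall>p\<in>X. g p = G p))"

text \<open>As in \<^const>\<open>BijGroup\<close>, automorphisms are taken to be extensional functions on \<open>X\<close>.\<close>

definition Aut :: "('k::comm_ring_1 ^ 'n) set \<Rightarrow> ('k ^ 'n \<Rightarrow> 'k ^ 'n) monoid" where
  "Aut X = (BijGroup X)
     \<lparr>carrier := {g \<in> Bij X. regular_on X g \<and> regular_on X (inv_into X g)}\<rparr>"

subsection \<open>Actions of the additive group\<close>

definition Ga :: "'k::comm_ring_1 monoid" where
  "Ga = \<lparr>carrier = UNIV, mult = (+), one = 0\<rparr>"

definition effective_Ga_action ::
    "('k::comm_ring_1 ^ 'n) set \<Rightarrow> ('k \<Rightarrow> 'k ^ 'n \<Rightarrow> 'k ^ 'n) \<Rightarrow> bool" where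
  "effective_Ga_action X \<phi> \<longleftrightarrow> faithful_action Ga X \<phi> \<and>
     (\<exists>\<Phi>. (\<forall>i. (\<lambda>q. \<Phi> q $ i) \<in> poly_funs coords_times) \<and> (\<forall>t. \<forall>p\<in>X. \<phi> t p = \<Phi> (t, p)))"

definition one_param_unipotent_subgroups ::
    "('k::comm_ring_1 ^ 'n) set \<Rightarrow> ('k ^ 'n \<Rightarrow> 'k ^ 'n) set set" where
  "one_param_unipotent_subgroups X = {range \<phi> |\<phi>. effective_Ga_action X \<phi>}"

definition SAut :: "('k::comm_ring_1 ^ 'n) set \<Rightarrow> ('k ^ 'n \<Rightarrow> 'k ^ 'n) monoid" where
  "SAut X = (Aut X)\<lparr>carrier := generate (Aut X) (\<Union> (one_param_unipotent_subgroups X))\<rparr>"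

subsection \<open>Tangent vectors, smooth points and flexibility\<close>

text \<open>Formal derivative at 0; only meaningful for polynomial functions \<open>g\<close>.\<close>

definition deriv0 :: "('k::field_char_0 \<Rightarrow> 'k) \<Rightarrow> 'k" where
  "deriv0 g = poly (pderiv (THE q. \<forall>t. poly q t = g t)) 0"

text \<open>The differential of the polynomial function \<open>F\<close> at \<open>p\<close>, applied to \<open>w\<close>.\<close>

definition differential ::
    "('k::field_char_0 ^ 'n \<Rightarrow> 'k) \<Rightarrow> 'k ^ 'n \<Rightarrow> 'k ^ 'n \<Rightarrow> 'k" where
  "differential F p w = deriv0 (\<lambda>t. F (p + t *s w))"

text \<open>
  The next definitions concern the hypersurface with equation \<open>F = 0\<close>. Its smooth points are
  given by the Jacobian criterion: some partial derivative of \<open>F\<close> does not vanish.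
\<close>

definition zero_locus :: "('k::field_char_0 ^ 'n \<Rightarrow> 'k) \<Rightarrow> ('k ^ 'n) set" where
  "zero_locus F = {p. F p = 0}"

definition tangent_space ::
    "('k::field_char_0 ^ 'n \<Rightarrow> 'k) \<Rightarrow> 'k ^ 'n \<Rightarrow> ('k ^ 'n) set" where
  "tangent_space F p = {w. differential F p w = 0}"

definition smooth_points :: "('k::field_char_0 ^ 'n \<Rightarrow> 'k) \<Rightarrow> ('k ^ 'n) set" where
  "smooth_points F = {p \<in> zero_locus F. \<exists>i. differential F p (axis i 1) \<noteq> 0}"

text \<open>
  The tangent vector at \<open>p\<close> to the orbit of \<open>p\<close>. Replacing \<open>\<phi>\<close> by another parametrization of
  the same subgroup only rescales it.
\<close>

definition orbit_tangent ::
    "('k::field_char_0 \<Rightarrow> 'k ^ 'n \<Rightarrow> 'k ^ 'n) \<Rightarrow> 'k ^ 'n \<Rightarrow> 'k ^ 'n" where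
  "orbit_tangent \<phi> p = (\<chi> i. deriv0 (\<lambda>t. \<phi> t p $ i))"

definition flexible_point :: "('k::field_char_0 ^ 'n \<Rightarrow> 'k) \<Rightarrow> 'k ^ 'n \<Rightarrow> bool" where
  "flexible_point F p \<longleftrightarrow>
     vec.span {orbit_tangent \<phi> p |\<phi>. effective_Ga_action (zero_locus F) \<phi>} = tangent_space F p"

definition flexible :: "('k::field_char_0 ^ 'n \<Rightarrow> 'k) \<Rightarrow> bool" where
  "flexible F \<longleftrightarrow> (\<forall>p\<in>smooth_points F. flexible_point F p)"

subsection \<open>Multiple transitivity\<close>

definition m_transitive_action ::
    "nat \<Rightarrow> ('g, 'b) monoid_scheme \<Rightarrow> 'a set \<Rightarrow> ('g \<Rightarrow> 'a \<Rightarrow> 'a) \<Rightarrow> bool" where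
  "m_transitive_action m G A \<phi> \<longleftrightarrow> group_action G A \<phi> \<and>
     (\<forall>as bs. length as = m \<and> distinct as \<and> set as \<subseteq> A \<and>
              length bs = m \<and> distinct bs \<and> set bs \<subseteq> A \<longrightarrow>
        (\<exists>g\<in>carrier G. \<forall>i<m. \<phi> g (as ! i) = bs ! i))"

subsection \<open>The surface \<open>f(x) - u v = 0\<close>\<close>

text \<open>The coordinates \<open>x\<close>, \<open>u\<close>, \<open>v\<close> are the components 1, 2, 3.\<close>

definition suspension_eq :: "'k::field_char_0 poly \<Rightarrow> 'k ^ 3 \<Rightarrow> 'k" where
  "suspension_eq f p = poly f (p $ 1) - p $ 2 * p $ 3"

end

theory Submission
  imports Defs
begin

text \<open>
  Write points of the surface \<open>X = {f(x) = u v}\<close> as \<open>(x, u, v)\<close>. For every polynomial \<open>q\<close> the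
  derivation \<open>x \<mapsto> u q(u)\<close>, \<open>u \<mapsto> 0\<close>, \<open>v \<mapsto> q(u) f'(x)\<close> integrates to an action of the additive group:
  \<open>u\<close> is fixed, \<open>x\<close> is translated by \<open>t u q(u)\<close>, and \<open>v\<close> is adjusted by a divided difference
  of \<open>f\<close>. These are the shears; exchanging \<open>u\<close> and \<open>v\<close> gives the coshears. Where \<open>u \<noteq> 0\<close> the
  point is determined by \<open>(x, u)\<close>, and by interpolation a shear can translate \<open>x\<close> by any amount
  that depends on \<open>u\<close> alone, independently for finitely many nonzero values of \<open>u\<close>.

  Transitivity. Any \<open>m\<close> distinct smooth points are moved to the single tuple
  \<open>(0, i, f(0) / i)\<close>, \<open>i = 1, \<dots>, m\<close> (\<open>move_to_standard_tuple\<close>), which suffices since SAut is a group.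
  A generic coshear makes all \<open>u\<close> nonzero (\<open>make_u_nonzero\<close>; this is where smoothness is used: at a
  point with \<open>u = v = 0\<close> the coordinate \<open>u\<close> moves with speed \<open>f'(x) \<noteq> 0\<close>). A suitable shear
  then makes the \<open>v\<close> nonzero and pairwise distinct (\<open>make_v_distinct\<close>): points with the same \<open>u\<close> are
  separated because a nonconstant polynomial in characteristic zero has no period, points with
  different \<open>u\<close> because their translations can be chosen independently. Now a coshear may
  prescribe all the \<open>x\<close>; as \<open>f\<close> takes every value, they can be chosen with \<open>f(x) = i v\<close>, so
  that \<open>u = i\<close> afterwards. A last shear brings every \<open>x\<close> to \<open>0\<close>.

  Flexibility. Where \<open>f'(x) \<noteq> 0\<close> the tangent vectors of the shear and of the coshear with \<open>q = 1\<close>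
  span the tangent plane. Such a point is smooth, so transitivity carries it to any other smooth
  point, and conjugation by an automorphism carries one-parameter unipotent subgroups to
  one-parameter unipotent subgroups and orbit tangents to orbit tangents (\<open>flexible_point_image\<close>).

  Both the action on smooth points and this transport need that automorphisms of \<open>X\<close> map tangent
  spaces isomorphically. Since automorphisms are only known as maps of \<open>X\<close> to itself, this rests on the fact
  that a polynomial function vanishing on \<open>X\<close> is a multiple of \<open>f(x) - u v\<close>
  (\<open>reduced_suspension_eq\<close>), whence its differential vanishes on tangent vectors.
\<close>

section \<open>Polynomial functions, polynomial maps and their derivatives\<close>

lemma poly_funs_minus:
  assumes "g \<in> poly_funs C" "h \<in> poly_funs C"
  shows "(\<lambda>p. g p - h p) \<in> poly_funs C"
  using poly_funs.add[OF assms(1) poly_funs.mult[OF poly_funs.const[of "-1"] assms(2)]] by simp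

lemma poly_funs_poly:
  assumes "g \<in> poly_funs C"
  shows "(\<lambda>p. poly q (g p)) \<in> poly_funs C"
proof (induction q)
  case 0
  show ?case using poly_funs.const[of 0 C] by simp
next
  case (pCons a q)
  show ?case
    using poly_funs.add[OF poly_funs.const[of a] poly_funs.mult[OF assms pCons.IH]] by simp
qed

text \<open>The quotient of \<open>q(y) - q(x)\<close> by \<open>y - x\<close> is
  \<open>poly (synthetic_div q x) y\<close>; it is polynomial in both variables because the recursion of synthetic
  division along the coefficients of \<open>q\<close> uses only evaluation, addition and multiplication.\<close>

lemma poly_funs_synthetic_div:
  assumes "g \<in> poly_funs C" "h \<in> poly_funs C"
  shows "(\<lambda>p. poly (synthetic_div q (g p)) (h p)) \<in> poly_funs C"
proof (induction q)
  case 0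
  show ?case using poly_funs.const[of 0 C] by simp
next
  case (pCons a q)
  show ?case
    using poly_funs.add[OF poly_funs_poly[OF assms(1), of q] poly_funs.mult[OF assms(2) pCons.IH]]
    by simp
qed

lemma poly_funs_compose:
  assumes "g \<in> poly_funs C" and "\<And>c. c \<in> C \<Longrightarrow> (\<lambda>p. c (\<Phi> p)) \<in> poly_funs D"
  shows "(\<lambda>p. g (\<Phi> p)) \<in> poly_funs D"
  using assms(1) by induction (auto intro: poly_funs.intros assms(2))

definition poly_map :: "('k::comm_ring_1 ^ 'n \<Rightarrow> 'k ^ 'n) \<Rightarrow> bool" where
  "poly_map G \<longleftrightarrow> (\<forall>i. (\<lambda>p. G p $ i) \<in> poly_funs coords)"

lemma poly_funs_coords_nth: "(\<lambda>p. p $ i) \<in> poly_funs coords"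
  by (rule poly_funs.coord) (auto simp: coords_def)

lemma poly_funs_compose_coords:
  assumes "g \<in> poly_funs coords" and "\<And>i. (\<lambda>p. G p $ i) \<in> poly_funs D"
  shows "(\<lambda>p. g (G p)) \<in> poly_funs D"
  using assms(1) by (rule poly_funs_compose) (auto simp: coords_def assms(2))

lemma poly_map_compose: "poly_map G \<Longrightarrow> poly_map H \<Longrightarrow> poly_map (\<lambda>p. G (H p))"
  by (auto simp: poly_map_def intro: poly_funs_compose_coords)

lemma poly_map_id: "poly_map (\<lambda>p. p)"
  by (auto simp: poly_map_def intro: poly_funs_coords_nth)

definition polynomial_curve :: "('k::comm_ring_1 \<Rightarrow> 'k ^ 'n) \<Rightarrow> bool" where
  "polynomial_curve \<gamma> \<longleftrightarrow> (\<forall>i. \<exists>q. \<forall>t. \<gamma> t $ i = poly q t)"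

definition velocity :: "('k::field_char_0 \<Rightarrow> 'k ^ 'n) \<Rightarrow> 'k ^ 'n" where
  "velocity \<gamma> = (\<chi> i. deriv0 (\<lambda>t. \<gamma> t $ i))"

definition gradient :: "('k::field_char_0 ^ 'n \<Rightarrow> 'k) \<Rightarrow> 'k ^ 'n \<Rightarrow> 'k ^ 'n" where
  "gradient g p = (\<chi> i. differential g p (axis i 1))"

lemma deriv0_eq:
  assumes "\<And>t. g t = poly q t"
  shows "deriv0 g = poly (pderiv q) 0"
proof -
  have "(THE q'. \<forall>t. poly q' t = g t) = q"
    by (rule the_equality) (auto simp: assms intro: poly_ext)
  then show ?thesis by (simp add: deriv0_def)
qed

text \<open>By induction on the construction of \<open>g\<close>, with the sum and product rules: the
  derivative of \<open>g\<close> along a polynomial curve through \<open>p\<close> is a fixed linear form \<open>d\<close> in the velocity. The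
  vector \<open>d\<close> must be chosen before the curve, since this independence is the chain rule.\<close>

lemma derivative_along_curves:
  fixes g :: "'k::field_char_0 ^ 'n \<Rightarrow> 'k"
  assumes "g \<in> poly_funs coords"
  obtains d where "\<And>c. (\<And>i. poly (c i) 0 = p $ i) \<Longrightarrow>
     \<exists>r. (\<forall>t. g (\<chi> i. poly (c i) t) = poly r t) \<and>
         poly (pderiv r) 0 = (\<Sum>i\<in>UNIV. d $ i * poly (pderiv (c i)) 0)"
proof -
  have "\<exists>d. \<forall>c. (\<forall>i. poly (c i) 0 = p $ i) \<longrightarrow>
     (\<exists>r. (\<forall>t. g (\<chi> i. poly (c i) t) = poly r t) \<and>
         poly (pderiv r) 0 = (\<Sum>i\<in>UNIV. (d :: 'k ^ 'n) $ i * poly (pderiv (c i)) 0))"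
    using assms
  proof induction
    case (const a)
    show ?case by (rule exI[of _ 0], intro allI impI, rule exI[of _ "[:a:]"]) simp
  next
    case (coord g)
    then obtain j where g: "g = (\<lambda>p. p $ j)" by (auto simp: coords_def)
    show ?case
    proof (rule exI[of _ "axis j 1"], intro allI impI)
      fix c :: "'n \<Rightarrow> 'k poly"
      have "(\<Sum>i\<in>UNIV. axis j 1 $ i * poly (pderiv (c i)) 0) =
            (\<Sum>i\<in>UNIV. if i = j then poly (pderiv (c i)) 0 else 0)"
        by (intro sum.cong) (auto simp: axis_def)
      then show "\<exists>r. (\<forall>t. g (\<chi> i. poly (c i) t) = poly r t) \<and>
         poly (pderiv r) 0 = (\<Sum>i\<in>UNIV. axis j 1 $ i * poly (pderiv (c i)) 0)"
        by (intro exI[of _ "c j"]) (simp add: g)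
    qed
  next
    case (add g h)
    then obtain d e where
      d: "\<And>c. (\<forall>i. poly (c i) 0 = p $ i) \<Longrightarrow> (\<exists>r. (\<forall>t. g (\<chi> i. poly (c i) t) = poly r t) \<and>
         poly (pderiv r) 0 = (\<Sum>i\<in>UNIV. (d :: 'k ^ 'n) $ i * poly (pderiv (c i)) 0))" and
      e: "\<And>c. (\<forall>i. poly (c i) 0 = p $ i) \<Longrightarrow> (\<exists>r. (\<forall>t. h (\<chi> i. poly (c i) t) = poly r t) \<and>
         poly (pderiv r) 0 = (\<Sum>i\<in>UNIV. (e :: 'k ^ 'n) $ i * poly (pderiv (c i)) 0))"
      by blast
    show ?case
    proof (rule exI[of _ "d + e"], intro allI impI)
      fix c :: "'n \<Rightarrow> 'k poly" assume c: "\<forall>i. poly (c i) 0 = p $ i"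
      obtain r s where "(\<forall>t. g (\<chi> i. poly (c i) t) = poly r t) \<and>
         poly (pderiv r) 0 = (\<Sum>i\<in>UNIV. d $ i * poly (pderiv (c i)) 0)"
        "(\<forall>t. h (\<chi> i. poly (c i) t) = poly s t) \<and>
         poly (pderiv s) 0 = (\<Sum>i\<in>UNIV. e $ i * poly (pderiv (c i)) 0)"
        using d[OF c] e[OF c] by blast
      then show "\<exists>r. (\<forall>t. g (\<chi> i. poly (c i) t) + h (\<chi> i. poly (c i) t) = poly r t) \<and>
         poly (pderiv r) 0 = (\<Sum>i\<in>UNIV. (d + e) $ i * poly (pderiv (c i)) 0)"
        by (intro exI[of _ "r + s"]) (simp add: pderiv_add algebra_simps sum.distrib)
    qed
  next
    case (mult g h)
    then obtain d e where
      d: "\<And>c. (\<forall>i. poly (c i) 0 = p $ i) \<Longrightarrow> (\<exists>r. (\<forall>t. g (\<chi> i. poly (c i) t) = poly r t) \<and>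
         poly (pderiv r) 0 = (\<Sum>i\<in>UNIV. (d :: 'k ^ 'n) $ i * poly (pderiv (c i)) 0))" and
      e: "\<And>c. (\<forall>i. poly (c i) 0 = p $ i) \<Longrightarrow> (\<exists>r. (\<forall>t. h (\<chi> i. poly (c i) t) = poly r t) \<and>
         poly (pderiv r) 0 = (\<Sum>i\<in>UNIV. (e :: 'k ^ 'n) $ i * poly (pderiv (c i)) 0))"
      by blast
    show ?case
    proof (rule exI[of _ "g p *s e + h p *s d"], intro allI impI)
      fix c :: "'n \<Rightarrow> 'k poly" assume c: "\<forall>i. poly (c i) 0 = p $ i"
      obtain r s where r: "\<And>t. g (\<chi> i. poly (c i) t) = poly r t"
         "poly (pderiv r) 0 = (\<Sum>i\<in>UNIV. d $ i * poly (pderiv (c i)) 0)"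
        and s: "\<And>t. h (\<chi> i. poly (c i) t) = poly s t"
         "poly (pderiv s) 0 = (\<Sum>i\<in>UNIV. e $ i * poly (pderiv (c i)) 0)"
        using d[OF c] e[OF c] by blast
      have p: "(\<chi> i. poly (c i) 0) = p" using c by (simp add: vec_eq_iff)
      have "poly r 0 = g p" "poly s 0 = h p" using r(1)[of 0] s(1)[of 0] p by auto
      then show "\<exists>r. (\<forall>t. g (\<chi> i. poly (c i) t) * h (\<chi> i. poly (c i) t) = poly r t) \<and>
         poly (pderiv r) 0 = (\<Sum>i\<in>UNIV. (g p *s e + h p *s d) $ i * poly (pderiv (c i)) 0)"
        using r s by (intro exI[of _ "r * s"])
          (simp add: pderiv_mult algebra_simps sum.distrib sum_distrib_left)
    qed
  qed
  then show ?thesis using that by blast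
qed

lemma polynomial_curve_line: "polynomial_curve (\<lambda>t. p + t *s w)"
  unfolding polynomial_curve_def
  by (intro allI, rule_tac x="[:p $ i, w $ i:]" in exI) simp

lemma velocity_line: "velocity (\<lambda>t. p + t *s w) = w"
proof -
  have "deriv0 (\<lambda>t. (p + t *s w) $ i) = w $ i" for i
    by (subst deriv0_eq[of _ "[:p $ i, w $ i:]"]) (simp_all add: pderiv_pCons)
  then show ?thesis by (simp add: velocity_def vec_eq_iff)
qed

text \<open>The linear form of the preceding lemma is the gradient, as one sees by testing it on
  lines parallel to the axes.\<close>

lemma differential_along_curve:
  fixes g :: "'k::field_char_0 ^ 'n \<Rightarrow> 'k"
  assumes g: "g \<in> poly_funs coords" and \<gamma>: "polynomial_curve \<gamma>"
  obtains r where "\<And>t. g (\<gamma> t) = poly r t"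
    "poly (pderiv r) 0 = (\<Sum>i\<in>UNIV. gradient g (\<gamma> 0) $ i * velocity \<gamma> $ i)"
proof -
  let ?p = "\<gamma> 0"
  obtain d where d: "\<And>c. (\<And>i. poly (c i) 0 = ?p $ i) \<Longrightarrow>
     \<exists>r. (\<forall>t. g (\<chi> i. poly (c i) t) = poly r t) \<and>
         poly (pderiv r) 0 = (\<Sum>i\<in>UNIV. d $ i * poly (pderiv (c i)) 0)"
    using derivative_along_curves[OF g] by blast
  have *: "\<exists>r. (\<forall>t. g (\<delta> t) = poly r t) \<and>
      poly (pderiv r) 0 = (\<Sum>i\<in>UNIV. d $ i * velocity \<delta> $ i)"
    if "polynomial_curve \<delta>" "\<delta> 0 = ?p" for \<delta>
  proof -
    from that(1) have "\<exists>c. \<forall>i t. \<delta> t $ i = poly (c i) t"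
      unfolding polynomial_curve_def by (rule choice)
    then obtain c where c: "\<And>i t. \<delta> t $ i = poly (c i) t" by blast
    have "\<delta> t = (\<chi> i. poly (c i) t)" for t by (simp add: vec_eq_iff c)
    moreover have "velocity \<delta> $ i = poly (pderiv (c i)) 0" for i
      by (simp add: velocity_def) (rule deriv0_eq, rule c)
    moreover have "\<forall>i. poly (c i) 0 = ?p $ i"
      using that(2) by (simp flip: c)
    ultimately show ?thesis using d[of c] by simp
  qed
  have "gradient g ?p = d"
  proof -
    have "differential g ?p (axis j 1) = d $ j" for j
    proof -
      obtain r where r: "\<forall>t. g (?p + t *s axis j 1) = poly r t"
        "poly (pderiv r) 0 = (\<Sum>i\<in>UNIV. d $ i * axis j 1 $ i)"
        using *[OF polynomial_curve_line, of ?p "axis j 1"] by (auto simp: velocity_line)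
      have "(\<Sum>i\<in>UNIV. d $ i * axis j 1 $ i) = (\<Sum>i\<in>UNIV. if i = j then d $ i else 0)"
        by (intro sum.cong) (auto simp: axis_def)
      then show ?thesis
        unfolding differential_def using deriv0_eq[of _ r] r by auto
    qed
    then show ?thesis by (simp add: gradient_def vec_eq_iff)
  qed
  then show ?thesis using *[OF \<gamma>] that by blast
qed

lemma differential_eq_gradient:
  assumes "g \<in> poly_funs coords"
  shows "differential g p w = (\<Sum>i\<in>UNIV. gradient g p $ i * w $ i)"
proof -
  obtain r where "\<And>t. g (p + t *s w) = poly r t"
    "poly (pderiv r) 0 = (\<Sum>i\<in>UNIV. gradient g p $ i * w $ i)"
    using differential_along_curve[OF assms polynomial_curve_line, of p w]
    by (auto simp: velocity_line)
  then show ?thesis unfolding differential_def using deriv0_eq[of _ r] by simp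
qed

lemma deriv0_along_curve:
  assumes "g \<in> poly_funs coords" "polynomial_curve \<gamma>"
  shows "deriv0 (\<lambda>t. g (\<gamma> t)) = differential g (\<gamma> 0) (velocity \<gamma>)"
  using differential_along_curve[OF assms] differential_eq_gradient[OF assms(1)] deriv0_eq
  by metis

lemma polynomial_curve_image:
  fixes G :: "'k::field_char_0 ^ 'n \<Rightarrow> 'k ^ 'n"
  assumes "poly_map G" "polynomial_curve \<gamma>"
  shows "polynomial_curve (\<lambda>t. G (\<gamma> t))"
  unfolding polynomial_curve_def
proof
  fix i
  have "(\<lambda>p. G p $ i) \<in> poly_funs coords" using assms(1) by (simp add: poly_map_def)
  from differential_along_curve[OF this assms(2)] show "\<exists>q. \<forall>t. G (\<gamma> t) $ i = poly q t" by metis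
qed

definition jacobian :: "('k::field_char_0 ^ 'n \<Rightarrow> 'k ^ 'n) \<Rightarrow> 'k ^ 'n \<Rightarrow> 'k ^ 'n ^ 'n" where
  "jacobian G p = (\<chi> i. gradient (\<lambda>p. G p $ i) p)"

lemma velocity_image:
  assumes "poly_map G" "polynomial_curve \<gamma>"
  shows "velocity (\<lambda>t. G (\<gamma> t)) = jacobian G (\<gamma> 0) *v velocity \<gamma>"
proof -
  have "deriv0 (\<lambda>t. G (\<gamma> t) $ i) = (jacobian G (\<gamma> 0) *v velocity \<gamma>) $ i" for i
  proof -
    have G: "(\<lambda>p. G p $ i) \<in> poly_funs coords" using assms(1) by (simp add: poly_map_def)
    show ?thesis
      using deriv0_along_curve[OF G assms(2)] differential_eq_gradient[OF G]
      by (simp add: jacobian_def matrix_vector_mult_def)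
  qed
  then show ?thesis by (simp add: vec_eq_iff velocity_def[of "\<lambda>t. G (\<gamma> t)"])
qed

lemma differential_compose:
  assumes "g \<in> poly_funs coords" "poly_map G"
  shows "differential (\<lambda>p. g (G p)) p w = differential g (G p) (jacobian G p *v w)"
proof -
  have "differential (\<lambda>p. g (G p)) p w = deriv0 (\<lambda>t. g (G (p + t *s w)))"
    by (simp add: differential_def)
  also have "\<dots> = differential g (G p) (velocity (\<lambda>t. G (p + t *s w)))"
    using deriv0_along_curve[OF assms(1) polynomial_curve_image[OF assms(2) polynomial_curve_line, of p w]]
    by simp
  also have "velocity (\<lambda>t. G (p + t *s w)) = jacobian G p *v w"
    using velocity_image[OF assms(2) polynomial_curve_line, of p w] by (simp add: velocity_line)
  finally show ?thesis .
qed

lemma differential_nth: "differential (\<lambda>p. p $ i) p w = w $ i"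
  unfolding differential_def using velocity_line[of p w]
  by (simp add: velocity_def vec_eq_iff del: vector_add_component)

text \<open>The ideal of the set of rational zeros of \<open>F\<close> is generated by \<open>F\<close>. Over a field that is not
  algebraically closed this is stronger than \<open>F\<close> being squarefree.\<close>

definition reduced_equation :: "('k::field_char_0 ^ 'n \<Rightarrow> 'k) \<Rightarrow> bool" where
  "reduced_equation F \<longleftrightarrow> F \<in> poly_funs coords \<and>
     (\<forall>g \<in> poly_funs coords. (\<forall>p\<in>zero_locus F. g p = 0) \<longrightarrow>
        (\<exists>c \<in> poly_funs coords. \<forall>p. g p = c p * F p))"

text \<open>The difference of two functions that agree on the hypersurface is \<open>c F\<close>, whose differential
  at a zero of \<open>F\<close> is \<open>c(p)\<close> times that of \<open>F\<close>.\<close>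

lemma differential_cong_on_tangent_space:
  assumes F: "reduced_equation F" and g: "g \<in> poly_funs coords" and h: "h \<in> poly_funs coords"
    and eq: "\<And>p. p \<in> zero_locus F \<Longrightarrow> g p = h p"
    and p: "p \<in> zero_locus F" and w: "w \<in> tangent_space F p"
  shows "differential g p w = differential h p w"
proof -
  let ?l = "\<lambda>t. p + t *s w"
  have Fp: "F \<in> poly_funs coords" using F by (simp add: reduced_equation_def)
  obtain c where c: "c \<in> poly_funs coords" "\<And>p. g p - h p = c p * F p"
    using F poly_funs_minus[OF g h] eq unfolding reduced_equation_def by fastforce
  obtain r where r: "\<And>t. h (?l t) = poly r t"
    using differential_along_curve[OF h polynomial_curve_line] by metis
  obtain s where s: "\<And>t. c (?l t) = poly s t"
    using differential_along_curve[OF c(1) polynomial_curve_line] by metis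
  obtain z where z: "\<And>t. F (?l t) = poly z t"
    using differential_along_curve[OF Fp polynomial_curve_line] by metis
  have "poly z 0 = 0" using z[of 0] p by (simp add: zero_locus_def)
  moreover have "poly (pderiv z) 0 = 0"
    using w deriv0_eq[of "\<lambda>t. F (?l t)" z] z by (simp add: tangent_space_def differential_def)
  moreover have "g (?l t) = poly (r + s * z) t" for t
    using c(2)[of "?l t"] by (simp add: r s z algebra_simps flip: r s z)
  ultimately show ?thesis
    unfolding differential_def using deriv0_eq[of "\<lambda>t. g (?l t)" "r + s * z"]
      deriv0_eq[of "\<lambda>t. h (?l t)" r] r by (simp add: pderiv_add pderiv_mult)
qed

section \<open>Automorphisms and flows\<close>

text \<open>The pair \<open>G\<close>, \<open>H\<close> of polynomial maps of the ambient space represents an automorphism of \<open>X\<close>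
  and its inverse; off \<open>X\<close> the two maps are arbitrary and need not be inverse to each other.\<close>

definition polynomially_inverse ::
    "('k::comm_ring_1 ^ 'n) set \<Rightarrow> ('k ^ 'n \<Rightarrow> 'k ^ 'n) \<Rightarrow> ('k ^ 'n \<Rightarrow> 'k ^ 'n) \<Rightarrow> bool" where
  "polynomially_inverse X G H \<longleftrightarrow> poly_map G \<and> poly_map H \<and>
     (\<forall>p\<in>X. G p \<in> X \<and> H p \<in> X \<and> H (G p) = p \<and> G (H p) = p)"

lemma polynomially_inverse_sym: "polynomially_inverse X G H \<Longrightarrow> polynomially_inverse X H G"
  by (auto simp: polynomially_inverse_def)

lemma polynomially_inverse_compose:
  "polynomially_inverse X G H \<Longrightarrow> polynomially_inverse X G' H' \<Longrightarrow>
   polynomially_inverse X (\<lambda>p. G (G' p)) (\<lambda>p. H' (H p))"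
  by (auto simp: polynomially_inverse_def intro: poly_map_compose)

lemma regular_on_iff: "regular_on X g \<longleftrightarrow> (\<exists>G. poly_map G \<and> (\<forall>p\<in>X. g p = G p))"
  by (simp add: regular_on_def poly_map_def)

lemma inv_into_polynomially_inverse:
  assumes "polynomially_inverse X G H" "p \<in> X"
  shows "inv_into X (restrict G X) p = H p"
proof -
  have "inj_on (restrict G X) X"
    using assms(1) by (auto simp: polynomially_inverse_def inj_on_def) metis
  from inv_into_f_f[OF this, of "H p"] show ?thesis
    using assms by (simp add: polynomially_inverse_def)
qed

lemma restrict_in_Bij:
  assumes "polynomially_inverse X G H"
  shows "restrict G X \<in> Bij X"
  using assms unfolding Bij_def polynomially_inverse_def
  by (auto intro!: bij_betw_byWitness[of _ H])

text \<open>Automorphisms are always handled through a pair of polynomially inverse maps, since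
  the differential calculus applies only to maps of the ambient space.\<close>

lemma carrier_Aut: "carrier (Aut X) = {restrict G X |G. \<exists>H. polynomially_inverse X G H}"
proof (intro subset_antisym subsetI)
  fix g assume "g \<in> carrier (Aut X)"
  then obtain G H where g: "g \<in> Bij X" and G: "poly_map G" "\<forall>p\<in>X. g p = G p"
    and H: "poly_map H" "\<forall>p\<in>X. inv_into X g p = H p"
    by (auto simp: Aut_def regular_on_iff)
  have bij: "bij_betw g X X" and ext: "g \<in> extensional X" using g by (auto simp: Bij_def)
  have "polynomially_inverse X G H"
    unfolding polynomially_inverse_def
  proof (intro conjI ballI)
    fix p assume p: "p \<in> X"
    show Gp: "G p \<in> X" using bij p G(2) by (metis bij_betwE)
    show Hp: "H p \<in> X" using Bij_inv_into_mem[OF g p] H(2) p by simp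
    show "H (G p) = p" using bij_betw_inv_into_left[OF bij p] G(2) H(2) p Gp by simp
    show "G (H p) = p" using bij_betw_inv_into_right[OF bij p] G(2) H(2) p Hp by simp
  qed (use G H in auto)
  moreover have "g = restrict G X"
    using ext G(2) by (intro extensionalityI[of _ X]) auto
  ultimately show "g \<in> {restrict G X |G. \<exists>H. polynomially_inverse X G H}" by blast
next
  fix g assume "g \<in> {restrict G X |G. \<exists>H. polynomially_inverse X G H}"
  then obtain G H where g: "g = restrict G X" and GH: "polynomially_inverse X G H" by blast
  have "regular_on X g" "regular_on X (inv_into X g)"
    using GH inv_into_polynomially_inverse[OF GH]
    by (auto simp: g regular_on_iff polynomially_inverse_def)
  then show "g \<in> carrier (Aut X)"
    using restrict_in_Bij[OF GH] by (simp add: Aut_def g)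
qed

lemma mult_Aut:
  assumes "polynomially_inverse X G H" "polynomially_inverse X G' H'"
  shows "restrict G X \<otimes>\<^bsub>Aut X\<^esub> restrict G' X = restrict (\<lambda>p. G (G' p)) X"
  using restrict_in_Bij[OF assms(1)] restrict_in_Bij[OF assms(2)] assms(2)
  by (auto simp: Aut_def BijGroup_def compose_def polynomially_inverse_def restrict_def)

lemma one_Aut: "\<one>\<^bsub>Aut X\<^esub> = restrict (\<lambda>p. p) X"
  by (simp add: Aut_def BijGroup_def)

lemma polynomially_inverse_id: "polynomially_inverse X (\<lambda>p. p) (\<lambda>p. p)"
  by (simp add: polynomially_inverse_def poly_map_id)

lemma group_Aut: "group (Aut X)"
proof (rule groupI)
  show "\<one>\<^bsub>Aut X\<^esub> \<in> carrier (Aut X)"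
    using polynomially_inverse_id by (fastforce simp: carrier_Aut one_Aut)
next
  fix x y assume "x \<in> carrier (Aut X)" "y \<in> carrier (Aut X)"
  then obtain G H G' H' where "x = restrict G X" "polynomially_inverse X G H"
    "y = restrict G' X" "polynomially_inverse X G' H'"
    by (auto simp: carrier_Aut)
  then show "x \<otimes>\<^bsub>Aut X\<^esub> y \<in> carrier (Aut X)"
    using polynomially_inverse_compose mult_Aut by (force simp: carrier_Aut)
next
  fix x y z assume "x \<in> carrier (Aut X)" "y \<in> carrier (Aut X)" "z \<in> carrier (Aut X)"
  then have "x \<in> carrier (BijGroup X)" "y \<in> carrier (BijGroup X)" "z \<in> carrier (BijGroup X)"
    by (auto simp: Aut_def BijGroup_def)
  from group.is_monoid[OF group_BijGroup, THEN monoid.m_assoc, OF this]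
  show "x \<otimes>\<^bsub>Aut X\<^esub> y \<otimes>\<^bsub>Aut X\<^esub> z = x \<otimes>\<^bsub>Aut X\<^esub> (y \<otimes>\<^bsub>Aut X\<^esub> z)"
    by (simp add: Aut_def)
next
  fix x assume "x \<in> carrier (Aut X)"
  then obtain G H where x: "x = restrict G X" and GH: "polynomially_inverse X G H"
    by (auto simp: carrier_Aut)
  note HG = polynomially_inverse_sym[OF GH]
  show "\<one>\<^bsub>Aut X\<^esub> \<otimes>\<^bsub>Aut X\<^esub> x = x"
    by (simp add: x one_Aut mult_Aut[OF polynomially_inverse_id GH])
  have "restrict H X \<otimes>\<^bsub>Aut X\<^esub> x = \<one>\<^bsub>Aut X\<^esub>"
    unfolding x one_Aut mult_Aut[OF HG GH] using GH
    by (auto simp: restrict_def polynomially_inverse_def)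
  then show "\<exists>y\<in>carrier (Aut X). y \<otimes>\<^bsub>Aut X\<^esub> x = \<one>\<^bsub>Aut X\<^esub>"
    using HG by (auto simp: carrier_Aut)
qed

text \<open>A polynomial map whose restriction to \<open>X\<close> is an effective action of the additive group,
  stated pointwise.\<close>

definition effective_flow ::
    "('k::comm_ring_1 ^ 'n) set \<Rightarrow> ('k \<times> ('k ^ 'n) \<Rightarrow> 'k ^ 'n) \<Rightarrow> bool" where
  "effective_flow X \<Phi> \<longleftrightarrow>
     (\<forall>i. (\<lambda>q. \<Phi> q $ i) \<in> poly_funs coords_times) \<and>
     (\<forall>p\<in>X. \<Phi> (0, p) = p \<and> (\<forall>t. \<Phi> (t, p) \<in> X) \<and> (\<forall>s t. \<Phi> (s + t, p) = \<Phi> (s, \<Phi> (t, p)))) \<and>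
     (\<forall>t. t \<noteq> 0 \<longrightarrow> (\<exists>p\<in>X. \<Phi> (t, p) \<noteq> p))"

lemma poly_map_time:
  assumes "\<And>i. (\<lambda>q. \<Phi> q $ i) \<in> poly_funs coords_times"
  shows "poly_map (\<lambda>p. \<Phi> (t, p))"
  unfolding poly_map_def
proof
  fix i
  show "(\<lambda>p. \<Phi> (t, p) $ i) \<in> poly_funs coords"
    by (rule poly_funs_compose[OF assms])
      (auto simp: coords_times_def intro: poly_funs.const poly_funs_coords_nth)
qed

lemma effective_flow_inverse:
  assumes "effective_flow X \<Phi>"
  shows "polynomially_inverse X (\<lambda>p. \<Phi> (t, p)) (\<lambda>p. \<Phi> (- t, p))"
proof -
  have map: "poly_map (\<lambda>p. \<Phi> (t, p))" for t
    by (rule poly_map_time) (use assms in \<open>auto simp: effective_flow_def\<close>)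
  have X: "\<Phi> (t, p) \<in> X" if "p \<in> X" for t p
    using assms that by (auto simp: effective_flow_def)
  have inv: "\<Phi> (- t, \<Phi> (t, p)) = p" if "p \<in> X" for t p
  proof -
    have "\<Phi> (- t + t, p) = \<Phi> (- t, \<Phi> (t, p))" "\<Phi> (0, p) = p"
      using assms that unfolding effective_flow_def by blast+
    then show ?thesis by simp
  qed
  show ?thesis
    unfolding polynomially_inverse_def using map X inv[of _ t] inv[of _ "- t"] by auto
qed

text \<open>Injectivity of the action amounts to every nonzero time moving some point: if the times \<open>s\<close> and \<open>t\<close>
  act alike, then \<open>s - t\<close> acts trivially.\<close>

lemma effective_Ga_action_iff:
  "effective_Ga_action X \<phi> \<longleftrightarrow>
     (\<exists>\<Phi>. effective_flow X \<Phi> \<and> \<phi> = (\<lambda>t. restrict (\<lambda>p. \<Phi> (t, p)) X))"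
proof
  assume L: "effective_Ga_action X \<phi>"
  then interpret faithful_action Ga X \<phi> by (simp add: effective_Ga_action_def)
  obtain \<Phi> where \<Phi>: "\<And>i. (\<lambda>q. \<Phi> q $ i) \<in> poly_funs coords_times"
    "\<And>t p. p \<in> X \<Longrightarrow> \<phi> t p = \<Phi> (t, p)"
    using L by (auto simp: effective_Ga_action_def)
  have Bij: "\<phi> t \<in> Bij X" for t by (rule bij_prop0) (simp add: Ga_def)
  have X: "\<phi> t p \<in> X" if "p \<in> X" for t p using Bij_imp_funcset[OF Bij] that by auto
  have zero: "\<phi> 0 = (\<lambda>p\<in>X. p)" using id_eq_one by (simp add: Ga_def)
  have eq: "\<phi> = (\<lambda>t. restrict (\<lambda>p. \<Phi> (t, p)) X)"
    using Bij_imp_extensional[OF Bij] \<Phi>(2) by (intro ext) (auto simp: extensional_def restrict_def)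
  have "effective_flow X \<Phi>"
    unfolding effective_flow_def
  proof (intro conjI ballI allI impI)
    fix p s t assume p: "p \<in> X"
    show "\<Phi> (0, p) = p" using zero \<Phi>(2)[OF p, of 0] p by simp
    show "\<Phi> (t, p) \<in> X" using X[OF p] \<Phi>(2)[OF p] by metis
    show "\<Phi> (s + t, p) = \<Phi> (s, \<Phi> (t, p))"
      using composition_rule[OF p, of s t] X[OF p] \<Phi>(2) p by (simp add: Ga_def)
  next
    fix t :: 'a assume "t \<noteq> 0"
    then have "\<phi> t \<noteq> \<phi> 0" using faithful by (auto simp: Ga_def inj_on_def)
    then have "\<exists>p. \<phi> t p \<noteq> \<phi> 0 p" by blast
    then show "\<exists>p\<in>X. \<Phi> (t, p) \<noteq> p"
      by (metis Bij Bij_imp_extensional \<Phi>(2) extensional_arb restrict_apply zero)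
  qed (rule \<Phi>(1))
  with eq show "\<exists>\<Phi>. effective_flow X \<Phi> \<and> \<phi> = (\<lambda>t. restrict (\<lambda>p. \<Phi> (t, p)) X)" by blast
next
  assume "\<exists>\<Phi>. effective_flow X \<Phi> \<and> \<phi> = (\<lambda>t. restrict (\<lambda>p. \<Phi> (t, p)) X)"
  then obtain \<Phi> where \<Phi>: "effective_flow X \<Phi>" and \<phi>: "\<phi> = (\<lambda>t. restrict (\<lambda>p. \<Phi> (t, p)) X)"
    by blast
  have Bij: "\<phi> t \<in> Bij X" for t
    unfolding \<phi> by (rule restrict_in_Bij[OF effective_flow_inverse[OF \<Phi>]])
  have hom: "\<phi> (s + t) = compose X (\<phi> s) (\<phi> t)" for s t
    using \<Phi> unfolding \<phi> effective_flow_def by (auto simp: compose_def)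
  have grp: "group (Ga :: 'a monoid)"
    by (rule groupI) (auto simp: Ga_def algebra_simps intro: exI[of _ "- x" for x])
  have "\<phi> \<in> hom Ga (BijGroup X)"
    using Bij hom by (auto simp: hom_def Ga_def BijGroup_def)
  then have act: "group_action Ga X \<phi>"
    using grp group_BijGroup
    by (intro group_action.intro group_hom.intro group_hom_axioms.intro)
  have "inj \<phi>"
  proof (rule injI, rule ccontr)
    fix s t assume eq: "\<phi> s = \<phi> t" and "s \<noteq> t"
    then obtain p where p: "p \<in> X" "\<Phi> (s - t, p) \<noteq> p"
      using \<Phi> unfolding effective_flow_def by (metis right_minus_eq)
    define q where "q = \<Phi> (- t, p)"
    have q: "q \<in> X" using p \<Phi> by (auto simp: effective_flow_def q_def)
    have "\<Phi> (s - t, p) = \<Phi> (s, q)" "\<Phi> (t, q) = \<Phi> (0, p)"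
      using \<Phi> p(1) unfolding effective_flow_def q_def
      by (metis diff_conv_add_uminus, metis add.right_inverse)
    moreover have "\<Phi> (s, q) = \<Phi> (t, q)" using fun_cong[OF eq, of q] q by (simp add: \<phi>)
    ultimately show False using p \<Phi> by (auto simp: effective_flow_def)
  qed
  then have "faithful_action Ga X \<phi>"
    using act by (simp add: faithful_action_def faithful_action_axioms_def Ga_def)
  then show "effective_Ga_action X \<phi>"
    using \<Phi> unfolding effective_Ga_action_def effective_flow_def \<phi> by auto
qed

lemma effective_flow_conjugate:
  assumes \<Phi>: "effective_flow X \<Phi>" and GH: "polynomially_inverse X G H"
  shows "effective_flow X (\<lambda>(t, p). G (\<Phi> (t, H p)))"
  unfolding effective_flow_def
proof (intro conjI ballI allI impI)
  fix i
  have H: "(\<lambda>q. H (snd q) $ j) \<in> poly_funs coords_times" for j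
    by (rule poly_funs_compose_coords)
      (use GH in \<open>auto simp: polynomially_inverse_def poly_map_def coords_times_def intro: poly_funs.coord\<close>)
  have *: "(\<lambda>q. \<Phi> (fst q, H (snd q)) $ j) \<in> poly_funs coords_times" for j
  proof (rule poly_funs_compose[of "\<lambda>q. \<Phi> q $ j" coords_times])
    show "(\<lambda>q. \<Phi> q $ j) \<in> poly_funs coords_times" using \<Phi> by (simp add: effective_flow_def)
    fix c :: "'a \<times> ('a ^ 'b) \<Rightarrow> 'a" assume "c \<in> coords_times"
    then show "(\<lambda>q. c (fst q, H (snd q))) \<in> poly_funs coords_times"
      using H by (auto simp: coords_times_def intro: poly_funs.coord)
  qed
  have "(\<lambda>q. G (\<Phi> (fst q, H (snd q))) $ i) \<in> poly_funs coords_times"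
    by (rule poly_funs_compose_coords[of "\<lambda>p. G p $ i"])
      (use GH * in \<open>auto simp: polynomially_inverse_def poly_map_def\<close>)
  then show "(\<lambda>q. (case q of (t, p) \<Rightarrow> G (\<Phi> (t, H p))) $ i) \<in> poly_funs coords_times"
    by (simp add: case_prod_unfold)
next
  fix t :: 'a assume "t \<noteq> 0"
  then obtain p where "p \<in> X" "\<Phi> (t, p) \<noteq> p" using \<Phi> by (auto simp: effective_flow_def)
  moreover from this have "\<Phi> (t, p) \<in> X" using \<Phi> by (auto simp: effective_flow_def)
  ultimately show "\<exists>p\<in>X. (case (t, p) of (t, p) \<Rightarrow> G (\<Phi> (t, H p))) \<noteq> p"
    using GH by (intro bexI[of _ "G p"]) (auto simp: polynomially_inverse_def, metis)
qed (use \<Phi> GH in \<open>auto simp: effective_flow_def polynomially_inverse_def\<close>)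

section \<open>Tangent spaces under automorphisms\<close>

lemma polynomial_curve_orbit:
  assumes "effective_flow X \<Phi>"
  shows "polynomial_curve (\<lambda>t. \<Phi> (t, p))"
  unfolding polynomial_curve_def
proof
  fix i
  have "(\<lambda>q. \<Phi> q $ i) \<in> poly_funs coords_times"
    using assms by (simp add: effective_flow_def)
  then show "\<exists>r. \<forall>t. \<Phi> (t, p) $ i = poly r t"
  proof induction
    case (const c)
    show ?case by (rule exI[of _ "[:c:]"]) simp
  next
    case (coord g)
    then consider "g = fst" | j where "g = (\<lambda>q. snd q $ j)" by (auto simp: coords_times_def)
    then show ?case
    proof cases
      case 1
      then show ?thesis by (intro exI[of _ "[:0, 1:]"]) simp
    next
      case (2 j)
      then show ?thesis by (intro exI[of _ "[:p $ j:]"]) simp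
    qed
  next
    case (add g h)
    then show ?case by (metis poly_add)
  next
    case (mult g h)
    then show ?case by (metis poly_mult)
  qed
qed

lemma orbit_tangent_flow:
  assumes "p \<in> X"
  shows "orbit_tangent (\<lambda>t. restrict (\<lambda>p. \<Phi> (t, p)) X) p = velocity (\<lambda>t. \<Phi> (t, p))"
  using assms by (simp add: orbit_tangent_def velocity_def)

lemma orbit_tangent_in_tangent_space:
  assumes F: "F \<in> poly_funs coords" and \<phi>: "effective_Ga_action (zero_locus F) \<phi>"
    and p: "p \<in> zero_locus F"
  shows "orbit_tangent \<phi> p \<in> tangent_space F p"
proof -
  obtain \<Phi> where \<Phi>: "effective_flow (zero_locus F) \<Phi>"
    and eq: "\<phi> = (\<lambda>t. restrict (\<lambda>p. \<Phi> (t, p)) (zero_locus F))"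
    using \<phi> by (auto simp: effective_Ga_action_iff)
  have "\<Phi> (0, p) = p" "F (\<Phi> (t, p)) = 0" for t
    using \<Phi> p by (auto simp: effective_flow_def zero_locus_def)
  then have "differential F p (velocity (\<lambda>t. \<Phi> (t, p))) = deriv0 (\<lambda>t. 0)"
    using deriv0_along_curve[OF F polynomial_curve_orbit[OF \<Phi>, of p]] by simp
  also have "\<dots> = 0" using deriv0_eq[of "\<lambda>t. 0" 0] by simp
  finally show ?thesis
    unfolding eq orbit_tangent_flow[OF p] tangent_space_def by simp
qed

lemma subspace_tangent_space:
  assumes "F \<in> poly_funs coords"
  shows "vec.subspace (tangent_space F p)"
  by (rule vec.subspaceI)
    (simp_all add: tangent_space_def differential_eq_gradient[OF assms] distrib_left sum.distrib
       mult.left_commute flip: sum_distrib_left)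

lemma flexible_pointI:
  assumes "F \<in> poly_funs coords" "p \<in> zero_locus F"
    and "tangent_space F p \<subseteq>
      vec.span {orbit_tangent \<phi> p |\<phi>. effective_Ga_action (zero_locus F) \<phi>}"
  shows "flexible_point F p"
  unfolding flexible_point_def
  using assms(3) orbit_tangent_in_tangent_space[OF assms(1) _ assms(2)]
  by (intro subset_antisym vec.span_minimal subspace_tangent_space assms(1)) auto

context
  fixes F :: "'k::field_char_0 ^ 'n \<Rightarrow> 'k" and G H :: "'k ^ 'n \<Rightarrow> 'k ^ 'n"
  assumes F: "reduced_equation F" and GH: "polynomially_inverse (zero_locus F) G H"
begin

lemma jacobian_tangent_space:
  assumes p: "p \<in> zero_locus F" and w: "w \<in> tangent_space F p"
  shows "jacobian G p *v w \<in> tangent_space F (G p)"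
proof -
  have Fp: "F \<in> poly_funs coords" using F by (simp add: reduced_equation_def)
  have G: "poly_map G" using GH by (simp add: polynomially_inverse_def)
  have "differential (\<lambda>p. F (G p)) p w = differential (\<lambda>p. 0) p w"
    by (rule differential_cong_on_tangent_space[OF F _ _ _ p w])
      (use G GH in \<open>auto simp: poly_map_def polynomially_inverse_def zero_locus_def
          intro: poly_funs_compose_coords[OF Fp] poly_funs.const\<close>)
  also have "\<dots> = 0" using deriv0_eq[of "\<lambda>t. 0" 0] by (simp add: differential_def)
  finally show ?thesis
    by (simp add: differential_compose[OF Fp G] tangent_space_def)
qed

text \<open>On the hypersurface \<open>H \<circ> G\<close> agrees with the identity, so their differentials agree on tangent
  vectors.\<close>

lemma jacobian_left_inverse:
  assumes p: "p \<in> zero_locus F" and w: "w \<in> tangent_space F p"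
  shows "jacobian H (G p) *v (jacobian G p *v w) = w"
proof -
  have G: "poly_map G" and H: "poly_map H" using GH by (auto simp: polynomially_inverse_def)
  have "(jacobian H (G p) *v (jacobian G p *v w)) $ i = w $ i" for i
  proof -
    have Hi: "(\<lambda>p. H p $ i) \<in> poly_funs coords" using H by (simp add: poly_map_def)
    have "(jacobian H (G p) *v (jacobian G p *v w)) $ i
        = differential (\<lambda>p. H p $ i) (G p) (jacobian G p *v w)"
      by (simp add: differential_eq_gradient[OF Hi] jacobian_def matrix_vector_mult_def)
    also have "\<dots> = differential (\<lambda>p. H (G p) $ i) p w"
      by (simp add: differential_compose[OF Hi G])
    also have "\<dots> = differential (\<lambda>p. p $ i) p w"
      by (rule differential_cong_on_tangent_space[OF F _ _ _ p w])
        (use poly_map_compose[OF H G] GH in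
          \<open>auto simp: poly_map_def polynomially_inverse_def intro: poly_funs_coords_nth\<close>)
    finally show ?thesis by (simp add: differential_nth)
  qed
  then show ?thesis by (simp add: vec_eq_iff)
qed

end

lemma jacobian_image_tangent_space:
  assumes F: "reduced_equation F" and GH: "polynomially_inverse (zero_locus F) G H"
    and p: "p \<in> zero_locus F"
  shows "(*v) (jacobian G p) ` tangent_space F p = tangent_space F (G p)"
proof (intro subset_antisym subsetI)
  fix w assume "w \<in> (*v) (jacobian G p) ` tangent_space F p"
  then show "w \<in> tangent_space F (G p)" using jacobian_tangent_space[OF F GH p] by auto
next
  fix w assume w: "w \<in> tangent_space F (G p)"
  have Gp: "G p \<in> zero_locus F" "H (G p) = p"
    using GH p by (auto simp: polynomially_inverse_def)
  note HG = polynomially_inverse_sym[OF GH]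
  have "jacobian H (G p) *v w \<in> tangent_space F p"
    "jacobian G p *v (jacobian H (G p) *v w) = w"
    using jacobian_tangent_space[OF F HG Gp(1) w] jacobian_left_inverse[OF F HG Gp(1) w] Gp(2)
    by simp_all
  then show "w \<in> (*v) (jacobian G p) ` tangent_space F p" by (metis imageI)
qed

lemma smooth_points_iff:
  assumes "F \<in> poly_funs coords"
  shows "p \<in> smooth_points F \<longleftrightarrow> p \<in> zero_locus F \<and> tangent_space F p \<noteq> UNIV"
proof -
  have "differential F p w = 0" if "\<forall>i. differential F p (axis i 1) = 0" for w
    using that by (simp add: differential_eq_gradient[OF assms, of p w] gradient_def)
  then show ?thesis by (auto simp: smooth_points_def tangent_space_def)
qed

text \<open>A point is singular exactly when its tangent space is the whole ambient space. If \<open>G p\<close> were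
  singular, the Jacobian matrix of \<open>H\<close> at \<open>G p\<close> would be left invertible, hence invertible, and it takes
  values in the tangent space at \<open>p\<close>; so \<open>p\<close> would be singular.\<close>

lemma smooth_points_image:
  assumes F: "reduced_equation F" and GH: "polynomially_inverse (zero_locus F) G H"
    and p: "p \<in> smooth_points F"
  shows "G p \<in> smooth_points F"
proof (rule ccontr)
  have Fp: "F \<in> poly_funs coords" using F by (simp add: reduced_equation_def)
  have pX: "p \<in> zero_locus F" and Tp: "tangent_space F p \<noteq> UNIV"
    using p by (auto simp: smooth_points_iff[OF Fp])
  have q: "G p \<in> zero_locus F" "H (G p) = p"
    using GH pX by (auto simp: polynomially_inverse_def)
  assume "G p \<notin> smooth_points F"
  then have T: "tangent_space F (G p) = UNIV" using q by (simp add: smooth_points_iff[OF Fp])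
  let ?A = "jacobian G p" and ?B = "jacobian H (G p)"
  have "?A *v (?B *v w) = w" for w
    using jacobian_left_inverse[OF F polynomially_inverse_sym[OF GH] q(1), of w] T q(2) by simp
  then have "?A ** ?B = mat 1" by (simp add: matrix_eq matrix_vector_mul_assoc)
  then have BA: "?B ** ?A = mat 1" by (simp add: matrix_left_right_inverse)
  have "w \<in> tangent_space F p" for w
  proof -
    have "?B *v (?A *v w) \<in> tangent_space F p"
      using jacobian_tangent_space[OF F polynomially_inverse_sym[OF GH] q(1), of "?A *v w"] T q(2)
      by simp
    then show ?thesis by (simp add: matrix_vector_mul_assoc BA)
  qed
  then show False using Tp by blast
qed

lemma velocity_conjugate:
  assumes \<Phi>: "effective_flow X \<Phi>" and GH: "polynomially_inverse X G H" and p: "p \<in> X"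
  shows "velocity (\<lambda>t. G (\<Phi> (t, H (G p)))) = jacobian G p *v velocity (\<lambda>t. \<Phi> (t, p))"
proof -
  have "H (G p) = p" "\<Phi> (0, p) = p" and G: "poly_map G"
    using assms by (auto simp: polynomially_inverse_def effective_flow_def)
  then show ?thesis using velocity_image[OF G polynomial_curve_orbit[OF \<Phi>, of p]] by simp
qed

text \<open>The flow conjugated by \<open>G\<close> has at \<open>G p\<close> the image under the Jacobian of the orbit tangent
  at \<open>p\<close>, and the Jacobian maps the tangent space at \<open>p\<close> onto the one at \<open>G p\<close>.\<close>

lemma flexible_point_image:
  assumes F: "reduced_equation F" and GH: "polynomially_inverse (zero_locus F) G H"
    and p: "p \<in> zero_locus F" and flex: "flexible_point F p"
  shows "flexible_point F (G p)"
proof (rule flexible_pointI)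
  let ?X = "zero_locus F"
  let ?S = "\<lambda>p. {orbit_tangent \<phi> p |\<phi>. effective_Ga_action ?X \<phi>}"
  show "F \<in> poly_funs coords" using F by (simp add: reduced_equation_def)
  show Gp: "G p \<in> ?X" using GH p by (auto simp: polynomially_inverse_def)
  have sub: "(*v) (jacobian G p) ` ?S p \<subseteq> ?S (G p)"
  proof clarify
    fix \<phi> assume "effective_Ga_action ?X \<phi>"
    then obtain \<Phi> where \<Phi>: "effective_flow ?X \<Phi>"
      and eq: "\<phi> = (\<lambda>t. restrict (\<lambda>p. \<Phi> (t, p)) ?X)"
      by (auto simp: effective_Ga_action_iff)
    let ?\<Psi> = "\<lambda>(t, p). G (\<Phi> (t, H p))"
    have "jacobian G p *v orbit_tangent \<phi> p = velocity (\<lambda>t. ?\<Psi> (t, G p))"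
      using velocity_conjugate[OF \<Phi> GH p] by (simp add: eq orbit_tangent_flow[OF p])
    also have "\<dots> = orbit_tangent (\<lambda>t. restrict (\<lambda>p. ?\<Psi> (t, p)) ?X) (G p)"
      by (rule orbit_tangent_flow[OF Gp, symmetric])
    finally show "\<exists>\<psi>. jacobian G p *v orbit_tangent \<phi> p = orbit_tangent \<psi> (G p) \<and>
        effective_Ga_action ?X \<psi>"
      using effective_flow_conjugate[OF \<Phi> GH] unfolding effective_Ga_action_iff by blast
  qed
  have "tangent_space F (G p) = (*v) (jacobian G p) ` vec.span (?S p)"
    using jacobian_image_tangent_space[OF F GH p] flex by (simp add: flexible_point_def)
  also have "\<dots> = vec.span ((*v) (jacobian G p) ` ?S p)"
    by (rule vec.linear_span_image[OF matrix_vector_mul_linear_gen, symmetric])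
  also have "\<dots> \<subseteq> vec.span (?S (G p))" using sub by (rule vec.span_mono)
  finally show "tangent_space F (G p) \<subseteq> vec.span (?S (G p))" .
qed

section \<open>The special automorphism group and its action on smooth points\<close>

lemma flow_in_Aut:
  assumes "effective_flow X \<Phi>"
  shows "restrict (\<lambda>p. \<Phi> (t, p)) X \<in> carrier (Aut X)"
  using effective_flow_inverse[OF assms] by (auto simp: carrier_Aut)

lemma one_param_unipotent_subgroups_subset:
  "\<Union> (one_param_unipotent_subgroups X) \<subseteq> carrier (Aut X)"
  using flow_in_Aut by (fastforce simp: one_param_unipotent_subgroups_def effective_Ga_action_iff)

lemma subgroup_SAut: "subgroup (carrier (SAut X)) (Aut X)"
  using group.generate_is_subgroup[OF group_Aut one_param_unipotent_subgroups_subset]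
  by (simp add: SAut_def)

lemma group_SAut: "group (SAut X)"
  using subgroup.subgroup_is_group[OF subgroup_SAut group_Aut] by (simp add: SAut_def)

lemma mult_SAut: "g \<otimes>\<^bsub>SAut X\<^esub> h = g \<otimes>\<^bsub>Aut X\<^esub> h"
  by (simp add: SAut_def)

lemma SAut_polynomially_inverse:
  assumes "g \<in> carrier (SAut X)"
  obtains G H where "polynomially_inverse X G H" "g = restrict G X"
  using subsetD[OF subgroup.subset[OF subgroup_SAut] assms] that by (auto simp: carrier_Aut)

lemma SAut_compose:
  assumes "g \<in> carrier (SAut X)" "h \<in> carrier (SAut X)"
  obtains k where "k \<in> carrier (SAut X)" "\<And>p. p \<in> X \<Longrightarrow> k p = g (h p)"
proof
  show "g \<otimes>\<^bsub>Aut X\<^esub> h \<in> carrier (SAut X)"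
    by (rule subgroup.m_closed[OF subgroup_SAut assms])
  obtain G H where G: "polynomially_inverse X G H" "g = restrict G X"
    using SAut_polynomially_inverse[OF assms(1)] .
  obtain G' H' where G': "polynomially_inverse X G' H'" "h = restrict G' X"
    using SAut_polynomially_inverse[OF assms(2)] .
  show "(g \<otimes>\<^bsub>Aut X\<^esub> h) p = g (h p)" if "p \<in> X" for p
    using mult_Aut[OF G(1) G'(1)] G G' that by (simp add: polynomially_inverse_def)
qed

lemma SAut_inverse:
  assumes "g \<in> carrier (SAut X)"
  obtains k where "k \<in> carrier (SAut X)" "\<And>p. p \<in> X \<Longrightarrow> k (g p) = p"
proof
  let ?k = "inv\<^bsub>Aut X\<^esub> g"
  show k: "?k \<in> carrier (SAut X)"
    by (rule subgroup.m_inv_closed[OF subgroup_SAut assms])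
  have g: "g \<in> carrier (Aut X)" using subgroup.subset[OF subgroup_SAut] assms by blast
  obtain G H where G: "polynomially_inverse X G H" "g = restrict G X"
    using SAut_polynomially_inverse[OF assms] .
  obtain G' H' where G': "polynomially_inverse X G' H'" "?k = restrict G' X"
    using SAut_polynomially_inverse[OF k] .
  have "?k \<otimes>\<^bsub>Aut X\<^esub> g = restrict (\<lambda>p. p) X"
    using group.l_inv[OF group_Aut g] by (simp add: one_Aut)
  then have "restrict (\<lambda>p. G' (G p)) X = restrict (\<lambda>p. p) X"
    unfolding G' unfolding G(2) mult_Aut[OF G'(1) G(1)] .
  then show "?k (g p) = p" if "p \<in> X" for p
    using G G' that by (auto simp: polynomially_inverse_def dest: fun_cong[of _ _ p])
qed

lemma SAut_mem:
  "g \<in> carrier (SAut X) \<Longrightarrow> p \<in> X \<Longrightarrow> g p \<in> X"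
  by (elim SAut_polynomially_inverse) (auto simp: polynomially_inverse_def)

lemma SAut_inj:
  "g \<in> carrier (SAut X) \<Longrightarrow> p \<in> X \<Longrightarrow> q \<in> X \<Longrightarrow> g p = g q \<longleftrightarrow> p = q"
  by (metis SAut_inverse)

lemma flow_in_SAut:
  assumes "effective_flow X \<Phi>"
  shows "restrict (\<lambda>p. \<Phi> (t, p)) X \<in> carrier (SAut X)"
proof -
  have "effective_Ga_action X (\<lambda>t. restrict (\<lambda>p. \<Phi> (t, p)) X)"
    using assms by (auto simp: effective_Ga_action_iff)
  then have "restrict (\<lambda>p. \<Phi> (t, p)) X \<in> \<Union> (one_param_unipotent_subgroups X)"
    by (auto simp: one_param_unipotent_subgroups_def)
  then show ?thesis by (simp add: SAut_def generate.incl)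
qed

lemma group_action_smooth_points:
  assumes F: "reduced_equation F"
  shows "group_action (SAut (zero_locus F)) (smooth_points F) (\<lambda>g. restrict g (smooth_points F))"
proof (intro group_action.intro group_hom.intro group_hom_axioms.intro group_SAut group_BijGroup)
  let ?X = "zero_locus F" and ?S = "smooth_points F"
  have sub: "?S \<subseteq> ?X" by (auto simp: smooth_points_def)
  have img: "G p \<in> ?S" "H p \<in> ?S" "G (H p) = p" "H (G p) = p"
    if "polynomially_inverse ?X G H" "p \<in> ?S" for G H p
    using smooth_points_image[OF F that] smooth_points_image[OF F polynomially_inverse_sym[OF that(1)] that(2)]
      that sub by (auto simp: polynomially_inverse_def)
  have Bij: "restrict g ?S \<in> Bij ?S" if g: "g \<in> carrier (SAut ?X)" for g
  proof -
    obtain G H where G: "polynomially_inverse ?X G H" "g = restrict G ?X"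
      using SAut_polynomially_inverse[OF g] .
    have "restrict g ?S = restrict G ?S" using G(2) sub by (auto simp: restrict_def intro!: ext)
    moreover have "bij_betw G ?S ?S"
      using img[OF G(1)] by (intro bij_betw_byWitness[of _ H]) auto
    ultimately show ?thesis by (simp add: Bij_def)
  qed
  show "(\<lambda>g. restrict g ?S) \<in> hom (SAut ?X) (BijGroup ?S)"
  proof (rule homI)
    fix g h assume g: "g \<in> carrier (SAut ?X)" and h: "h \<in> carrier (SAut ?X)"
    obtain G H where G: "polynomially_inverse ?X G H" "g = restrict G ?X"
      using SAut_polynomially_inverse[OF g] .
    obtain G' H' where G': "polynomially_inverse ?X G' H'" "h = restrict G' ?X"
      using SAut_polynomially_inverse[OF h] .
    have "restrict (g \<otimes>\<^bsub>SAut ?X\<^esub> h) ?S = compose ?S (restrict g ?S) (restrict h ?S)"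
      unfolding mult_SAut G(2) G'(2) mult_Aut[OF G(1) G'(1)]
      using sub img[OF G'(1)] by (auto simp: compose_def subsetD[OF sub] intro!: ext)
    then show "restrict (g \<otimes>\<^bsub>SAut ?X\<^esub> h) ?S =
        restrict g ?S \<otimes>\<^bsub>BijGroup ?S\<^esub> restrict h ?S"
      using Bij[OF g] Bij[OF h] by (simp add: BijGroup_def)
  qed (use Bij in \<open>simp add: BijGroup_def\<close>)
qed

text \<open>In a group action, two tuples that can both be moved to a common third one can be moved to
  each other. The common tuple \<open>Q\<close> may be arbitrary.\<close>

lemma m_transitive_smooth_pointsI:
  assumes F: "reduced_equation F"
    and move: "\<And>P. inj_on P {..<m} \<Longrightarrow> (\<And>i. i < m \<Longrightarrow> P i \<in> smooth_points F) \<Longrightarrow>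
      \<exists>g \<in> carrier (SAut (zero_locus F)). \<forall>i<m. g (P i) = Q i"
  shows "m_transitive_action m (SAut (zero_locus F)) (smooth_points F)
    (\<lambda>g. restrict g (smooth_points F))"
  unfolding m_transitive_action_def
proof (intro conjI allI impI group_action_smooth_points[OF F], elim conjE)
  fix as bs :: "('a ^ 'b) list"
  assume as: "length as = m" "distinct as" "set as \<subseteq> smooth_points F"
    and bs: "length bs = m" "distinct bs" "set bs \<subseteq> smooth_points F"
  let ?G = "carrier (SAut (zero_locus F))"
  have X: "smooth_points F \<subseteq> zero_locus F" by (auto simp: smooth_points_def)
  have *: "\<exists>g \<in> ?G. \<forall>i<m. g (xs ! i) = Q i"
    if "length xs = m" "distinct xs" "set xs \<subseteq> smooth_points F" for xs
    using that by (intro move) (auto simp: inj_on_def nth_eq_iff_index_eq)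
  obtain g h where g: "g \<in> ?G" "\<forall>i<m. g (as ! i) = Q i" and h: "h \<in> ?G" "\<forall>i<m. h (bs ! i) = Q i"
    using *[OF as] *[OF bs] by blast
  obtain k where k: "k \<in> ?G" "\<And>p. p \<in> zero_locus F \<Longrightarrow> k (h p) = p"
    using SAut_inverse[OF h(1)] by blast
  obtain r where r: "r \<in> ?G" "\<And>p. p \<in> zero_locus F \<Longrightarrow> r p = k (g p)"
    using SAut_compose[OF k(1) g(1)] by blast
  have "restrict r (smooth_points F) (as ! i) = bs ! i" if "i < m" for i
  proof -
    have a: "as ! i \<in> smooth_points F" and b: "bs ! i \<in> smooth_points F"
      using that as bs by auto
    have "r (as ! i) = k (h (bs ! i))" using r(2) a X g(2) h(2) that by auto
    also have "\<dots> = bs ! i" using k(2) b X by auto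
    finally show ?thesis using a by simp
  qed
  with r(1) show "\<exists>g\<in>?G. \<forall>i<m. restrict g (smooth_points F) (as ! i) = bs ! i" by blast
qed

section \<open>The equation \<open>f(x) - u v\<close> is reduced\<close>

lemma poly_funs_vanish_on_curve:
  fixes g :: "'k::field_char_0 ^ 'n \<Rightarrow> 'k"
  assumes "g \<in> poly_funs coords" "polynomial_curve \<gamma>" "finite S"
    and "\<And>t. t \<notin> S \<Longrightarrow> g (\<gamma> t) = 0"
  shows "g (\<gamma> t) = 0"
proof -
  obtain r where r: "\<And>t. g (\<gamma> t) = poly r t"
    using differential_along_curve[OF assms(1,2)] by metis
  have "r = 0"
  proof (rule ccontr)
    assume "r \<noteq> 0"
    then have "finite (S \<union> {t. poly r t = 0})" using assms(3) poly_roots_finite by blast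
    moreover have "S \<union> {t. poly r t = 0} = UNIV" using assms(4) r by auto
    ultimately show False using infinite_UNIV_char_0 by metis
  qed
  then show ?thesis using r by simp
qed

lemma suspension_eq_poly_fun: "suspension_eq f \<in> poly_funs coords"
  unfolding suspension_eq_def
  by (intro poly_funs_minus poly_funs_poly poly_funs.mult poly_funs_coords_nth)

text \<open>Modulo \<open>f(x) - u v\<close> the product \<open>u v\<close> can be replaced by \<open>f(x)\<close>, so multiplication by a power
  of \<open>u\<close> removes \<open>v\<close>. That \<open>h\<close> does not involve \<open>v\<close> is
  expressed by the freedom to change the third component of its argument.\<close>

lemma eliminate_third_coordinate:
  fixes f :: "'k::field_char_0 poly"
  assumes "g \<in> poly_funs coords"
  obtains N h C where "h \<in> poly_funs coords" "C \<in> poly_funs coords"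
    "\<And>p v. h (vector [p $ 1, p $ 2, v]) = h p"
    "\<And>p. p $ 2 ^ N * g p = h p + suspension_eq f p * C p"
proof -
  have "\<exists>N h C. h \<in> poly_funs coords \<and> C \<in> poly_funs coords \<and>
    (\<forall>p v. h (vector [p $ 1, p $ 2, v]) = h p) \<and>
    (\<forall>p. p $ 2 ^ N * g p = h p + suspension_eq f p * C p)"
    using assms
  proof induction
    case (const c)
    show ?case
      by (rule exI[of _ 0], rule exI[of _ "\<lambda>_. c"], rule exI[of _ "\<lambda>_. 0"])
        (auto intro: poly_funs.const)
  next
    case (coord g)
    then obtain i where g: "g = (\<lambda>p. p $ i)" by (auto simp: coords_def)
    show ?case
    proof (cases "i = 3")
      case True
      have "(\<lambda>p. poly f (p $ 1)) \<in> poly_funs coords" "(\<lambda>_. -1) \<in> poly_funs coords"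
        by (intro poly_funs_poly poly_funs_coords_nth poly_funs.const)+
      then show ?thesis unfolding g True
        by (intro exI[of _ 1] exI[of _ "\<lambda>p. poly f (p $ 1)"] exI[of _ "\<lambda>_. -1"])
          (simp add: suspension_eq_def)
    next
      case False
      then have i: "i = 1 \<or> i = 2" using exhaust_3[of i] by blast
      show ?thesis unfolding g using i
        by (intro exI[of _ 0] exI[of _ "\<lambda>p. p $ i"] exI[of _ "\<lambda>_. 0"])
          (auto intro: poly_funs.const poly_funs_coords_nth)
    qed
  next
    case (add g g')
    then obtain N h C N' h' C' where
      h: "h \<in> poly_funs coords" "C \<in> poly_funs coords"
        "\<And>p v. h (vector [p $ 1, p $ 2, v]) = h p"
        "\<And>p. p $ 2 ^ N * g p = h p + suspension_eq f p * C p" and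
      h': "h' \<in> poly_funs coords" "C' \<in> poly_funs coords"
        "\<And>p v. h' (vector [p $ 1, p $ 2, v]) = h' p"
        "\<And>p. p $ 2 ^ N' * g' p = h' p + suspension_eq f p * C' p"
      by blast
    have pow: "(\<lambda>p :: 'k ^ 3. p $ 2 ^ n) \<in> poly_funs coords" for n
      using poly_funs_poly[OF poly_funs_coords_nth, of "monom 1 n" 2] by (simp add: poly_monom)
    let ?h = "\<lambda>p. p $ 2 ^ N' * h p + p $ 2 ^ N * h' p"
    let ?C = "\<lambda>p. p $ 2 ^ N' * C p + p $ 2 ^ N * C' p"
    have "p $ 2 ^ (N + N') * (g p + g' p) = ?h p + suspension_eq f p * ?C p" for p
    proof -
      have "p $ 2 ^ (N + N') * (g p + g' p)
          = p $ 2 ^ N' * (p $ 2 ^ N * g p) + p $ 2 ^ N * (p $ 2 ^ N' * g' p)"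
        by (simp add: power_add algebra_simps)
      then show ?thesis unfolding h(4) h'(4) by (simp add: algebra_simps)
    qed
    moreover have "?h \<in> poly_funs coords" "?C \<in> poly_funs coords"
      by (intro poly_funs.add poly_funs.mult pow h(1,2) h'(1,2))+
    moreover have "?h (vector [p $ 1, p $ 2, v]) = ?h p" for p v
      using h(3) h'(3) by simp
    ultimately show ?case
      by (intro exI[of _ "N + N'"] exI[of _ ?h] exI[of _ ?C]) blast
  next
    case (mult g g')
    then obtain N h C N' h' C' where
      h: "h \<in> poly_funs coords" "C \<in> poly_funs coords"
        "\<And>p v. h (vector [p $ 1, p $ 2, v]) = h p"
        "\<And>p. p $ 2 ^ N * g p = h p + suspension_eq f p * C p" and
      h': "h' \<in> poly_funs coords" "C' \<in> poly_funs coords"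
        "\<And>p v. h' (vector [p $ 1, p $ 2, v]) = h' p"
        "\<And>p. p $ 2 ^ N' * g' p = h' p + suspension_eq f p * C' p"
      by blast
    let ?h = "\<lambda>p. h p * h' p"
    let ?C = "\<lambda>p. h p * C' p + C p * (h' p + suspension_eq f p * C' p)"
    have "p $ 2 ^ (N + N') * (g p * g' p) = ?h p + suspension_eq f p * ?C p" for p
    proof -
      have "p $ 2 ^ (N + N') * (g p * g' p) = (p $ 2 ^ N * g p) * (p $ 2 ^ N' * g' p)"
        by (simp add: power_add algebra_simps)
      then show ?thesis unfolding h(4) h'(4) by (simp add: algebra_simps)
    qed
    moreover have "?h \<in> poly_funs coords" "?C \<in> poly_funs coords"
      by (intro poly_funs.add poly_funs.mult suspension_eq_poly_fun h(1,2) h'(1,2))+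
    moreover have "?h (vector [p $ 1, p $ 2, v]) = ?h p" for p v
      using h(3) h'(3) by simp
    ultimately show ?case
      by (intro exI[of _ "N + N'"] exI[of _ ?h] exI[of _ ?C]) blast
  qed
  then show ?thesis using that by blast
qed

text \<open>Division with remainder by \<open>u\<close>.\<close>

lemma split_off_second_coordinate:
  fixes g :: "'k::field_char_0 ^ 3 \<Rightarrow> 'k"
  assumes "g \<in> poly_funs coords"
  obtains g' where "g' \<in> poly_funs coords"
    "\<And>p. g p = g (vector [p $ 1, 0, p $ 3]) + p $ 2 * g' p"
proof -
  let ?r = "\<lambda>p :: 'k ^ 3. vector [p $ 1, 0, p $ 3] :: 'k ^ 3"
  have r: "(\<lambda>p. ?r p $ i) \<in> poly_funs coords" for i
    using exhaust_3[of i] by (auto intro: poly_funs_coords_nth poly_funs.const)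
  have "\<exists>g' \<in> poly_funs coords. \<forall>p. g p = g (?r p) + p $ 2 * g' p"
    using assms
  proof induction
    case (const c)
    show ?case by (rule bexI[of _ "\<lambda>_. 0"]) (auto intro: poly_funs.const)
  next
    case (coord g)
    then obtain i where g: "g = (\<lambda>p. p $ i)" by (auto simp: coords_def)
    show ?case unfolding g using exhaust_3[of i]
      by (intro bexI[of _ "\<lambda>_. if i = 2 then 1 else 0"]) (auto intro: poly_funs.const)
  next
    case (add g h)
    then obtain g' h' where g': "g' \<in> poly_funs coords" "\<And>p. g p = g (?r p) + p $ 2 * g' p"
      and h': "h' \<in> poly_funs coords" "\<And>p. h p = h (?r p) + p $ 2 * h' p" by blast
    show ?case
    proof (rule bexI[of _ "\<lambda>p. g' p + h' p"], intro allI)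
      show "g p + h p = g (?r p) + h (?r p) + p $ 2 * (g' p + h' p)" for p
        by (subst g'(2), subst h'(2)) (simp add: algebra_simps)
    qed (intro poly_funs.add g' h')
  next
    case (mult g h)
    then obtain g' h' where g': "g' \<in> poly_funs coords" "\<And>p. g p = g (?r p) + p $ 2 * g' p"
      and h': "h' \<in> poly_funs coords" "\<And>p. h p = h (?r p) + p $ 2 * h' p" by blast
    show ?case
    proof (rule bexI[of _ "\<lambda>p. g' p * h p + g (?r p) * h' p"], intro allI)
      fix p
      have "g p * h p - g (?r p) * h (?r p)
          = (g p - g (?r p)) * h p + g (?r p) * (h p - h (?r p))" by (simp add: algebra_simps)
      also have "\<dots> = p $ 2 * g' p * h p + g (?r p) * (p $ 2 * h' p)"
        using g'(2)[of p] h'(2)[of p] by (metis add_diff_cancel_left')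
      finally show "g p * h p = g (?r p) * h (?r p) + p $ 2 * (g' p * h p + g (?r p) * h' p)"
        by (simp add: algebra_simps)
    next
      show "(\<lambda>p. g' p * h p + g (?r p) * h' p) \<in> poly_funs coords"
        by (intro poly_funs.add poly_funs.mult poly_funs_compose_coords[OF mult.hyps(1) r]
            g' h' mult.hyps)
    qed
  qed
  then show ?thesis using that by blast
qed

text \<open>The coordinate \<open>u\<close> does not divide \<open>f(x) - u v\<close>, because at \<open>u = 0\<close> there remains \<open>f(x) \<noteq> 0\<close>. So
  each factor \<open>u\<close> on the left divides \<open>C\<close> and can be cancelled.\<close>

lemma cancel_second_coordinate:
  fixes f :: "'k::field_char_0 poly"
  assumes f: "f \<noteq> 0" and g: "g \<in> poly_funs coords" and C: "C \<in> poly_funs coords"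
    and eq: "\<And>p. p $ 2 ^ N * g p = C p * suspension_eq f p"
  shows "\<exists>c \<in> poly_funs coords. \<forall>p. g p = c p * suspension_eq f p"
  using C eq
proof (induction N arbitrary: C)
  case 0
  then show ?case by auto
next
  case (Suc N)
  obtain C' where C': "C' \<in> poly_funs coords"
    "\<And>p. C p = C (vector [p $ 1, 0, p $ 3]) + p $ 2 * C' p"
    using split_off_second_coordinate[OF Suc.prems(1)] by blast
  \<comment> \<open>At \<open>u = 0\<close> the hypothesis reads \<open>0 = C f(x)\<close>, so \<open>C\<close> vanishes there off the roots of \<open>f\<close>, hence everywhere.\<close>
  have C0: "C (vector [x, 0, v]) = 0" for x v
  proof (rule poly_funs_vanish_on_curve[OF Suc.prems(1), of "\<lambda>x. vector [x, 0, v]" "{x. poly f x = 0}"])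
    have "\<exists>q. \<forall>t. (vector [t, 0, v] :: 'k ^ 3) $ i = poly q t" for i
      using exhaust_3[of i] by (auto intro: exI[of _ "[:0, 1:]"] exI[of _ 0] exI[of _ "[:v:]"])
    then show "polynomial_curve (\<lambda>x. vector [x, 0, v] :: 'k ^ 3)"
      by (simp add: polynomial_curve_def)
    show "finite {x. poly f x = 0}" using f by (rule poly_roots_finite)
    fix x assume "x \<notin> {x. poly f x = 0}"
    then show "C (vector [x, 0, v]) = 0"
      using Suc.prems(2)[of "vector [x, 0, v]"] by (simp add: suspension_eq_def)
  qed
  let ?d = "\<lambda>p. p $ 2 ^ N * g p - C' p * suspension_eq f p"
  have "(\<lambda>p :: 'k ^ 3. p $ 2 ^ N) \<in> poly_funs coords"
    using poly_funs_poly[OF poly_funs_coords_nth, of "monom 1 N" 2] by (simp add: poly_monom)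
  then have d: "?d \<in> poly_funs coords"
    by (intro poly_funs_minus poly_funs.mult g C'(1) suspension_eq_poly_fun)
  have u: "p $ 2 * ?d p = 0" for p
    using Suc.prems(2)[of p] C'(2)[of p] C0 by (simp add: algebra_simps)
  have "?d (vector [x, u, v]) = 0" for x u v
  proof (rule poly_funs_vanish_on_curve[OF d, of "\<lambda>u. vector [x, u, v]" "{0}"])
    have "\<exists>q. \<forall>t. (vector [x, t, v] :: 'k ^ 3) $ i = poly q t" for i
      using exhaust_3[of i] by (auto intro: exI[of _ "[:0, 1:]"] exI[of _ "[:x:]"] exI[of _ "[:v:]"])
    then show "polynomial_curve (\<lambda>u. vector [x, u, v] :: 'k ^ 3)"
      by (simp add: polynomial_curve_def)
    show "?d (vector [x, u, v]) = 0" if "u \<notin> {0}" for u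
      using u[of "vector [x, u, v]"] that by simp
  qed simp
  then have "\<forall>p. ?d p = 0" by (subst forall_vector_3) blast
  then show ?case by (intro Suc.IH[OF C'(1)]) simp
qed

text \<open>If \<open>g\<close> vanishes on the surface, write \<open>u^N g = h(x, u)\<close> modulo \<open>f(x) - u v\<close>. Over every
  \<open>(x, u)\<close> with \<open>u \<noteq> 0\<close> there lies a point of the surface, so \<open>h\<close> vanishes there, \<open>u^(N+1) g\<close> is a multiple of
  \<open>f(x) - u v\<close>, and the power of \<open>u\<close> can be cancelled.\<close>

lemma reduced_suspension_eq:
  fixes f :: "'k::field_char_0 poly"
  assumes f: "f \<noteq> 0"
  shows "reduced_equation (suspension_eq f)"
  unfolding reduced_equation_def
proof (intro conjI ballI impI suspension_eq_poly_fun)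
  fix g :: "'k ^ 3 \<Rightarrow> 'k"
  assume g: "g \<in> poly_funs coords" and zero: "\<forall>p\<in>zero_locus (suspension_eq f). g p = 0"
  obtain N h C where h: "h \<in> poly_funs coords" "C \<in> poly_funs coords"
    "\<And>p v. h (vector [p $ 1, p $ 2, v]) = h p"
    "\<And>p. p $ 2 ^ N * g p = h p + suspension_eq f p * C p"
    using eliminate_third_coordinate[OF g] by metis
  have h0: "h p = 0" if "p $ 2 \<noteq> 0" for p
  proof -
    let ?q = "vector [p $ 1, p $ 2, poly f (p $ 1) / p $ 2] :: 'k ^ 3"
    have "suspension_eq f ?q = 0" using that by (simp add: suspension_eq_def)
    then have "h ?q = 0" using h(4)[of ?q] zero by (simp add: zero_locus_def)
    then show ?thesis by (simp add: h(3))
  qed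
  show "\<exists>c\<in>poly_funs coords. \<forall>p. g p = c p * suspension_eq f p"
  proof (rule cancel_second_coordinate[OF f g, of "\<lambda>p. p $ 2 * C p" "Suc N"])
    show "(\<lambda>p. p $ 2 * C p) \<in> poly_funs coords"
      by (intro poly_funs.mult poly_funs_coords_nth h)
    have "p $ 2 ^ Suc N * g p = p $ 2 * (h p + suspension_eq f p * C p)" for p
      using h(4)[of p] by simp
    also have "\<dots> p = p $ 2 * C p * suspension_eq f p" for p
      using h0[of p] by (cases "p $ 2 = 0") simp_all
    finally show "p $ 2 ^ Suc N * g p = p $ 2 * C p * suspension_eq f p" for p .
  qed
qed

section \<open>Shears of the surface\<close>

abbreviation surface :: "'k::field_char_0 poly \<Rightarrow> ('k ^ 3) set" where
  "surface f \<equiv> zero_locus (suspension_eq f)"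

lemma poly_synthetic_div_diff:
  fixes f :: "'k::comm_ring_1 poly"
  shows "(y - x) * poly (synthetic_div f x) y = poly f y - poly f x"
proof -
  have "poly ([:- x, 1:] * synthetic_div f x + [:poly f x:]) y = poly f y"
    by (simp only: synthetic_div_correct')
  then show ?thesis by (simp add: algebra_simps)
qed

text \<open>The divided difference at coinciding arguments is the derivative.\<close>

lemma poly_synthetic_div_diagonal:
  fixes f :: "'k::{comm_ring_1,semiring_no_zero_divisors} poly"
  shows "poly (synthetic_div f x) x = poly (pderiv f) x"
  by (induction f) (simp_all add: pderiv_pCons)

text \<open>The flow of \<open>x \<mapsto> u q(u)\<close>, \<open>u \<mapsto> 0\<close>, \<open>v \<mapsto> q(u) f'(x)\<close>. On the surface the third component
  equals \<open>f(x + t u q(u)) / u\<close> where \<open>u \<noteq> 0\<close>; the divided difference continues it polynomially to \<open>u = 0\<close>.\<close>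

definition shear :: "'k::field_char_0 poly \<Rightarrow> 'k poly \<Rightarrow> 'k \<times> ('k ^ 3) \<Rightarrow> 'k ^ 3" where
  "shear f q = (\<lambda>(t, p). vector
     [p $ 1 + t * poly q (p $ 2) * p $ 2,
      p $ 2,
      p $ 3 + t * poly q (p $ 2) *
        poly (synthetic_div f (p $ 1)) (p $ 1 + t * poly q (p $ 2) * p $ 2)])"

lemma shear_nth:
  "shear f q (t, p) $ 1 = p $ 1 + t * poly q (p $ 2) * p $ 2"
  "shear f q (t, p) $ 2 = p $ 2"
  "shear f q (t, p) $ 3 = p $ 3 + t * poly q (p $ 2) *
        poly (synthetic_div f (p $ 1)) (p $ 1 + t * poly q (p $ 2) * p $ 2)"
  by (simp_all add: shear_def)

lemma mem_surface:
  "p \<in> surface f \<longleftrightarrow> poly f (p $ 1) = p $ 2 * p $ 3"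
  by (simp add: zero_locus_def suspension_eq_def)

lemma vec3_eq_iff: "p = q \<longleftrightarrow> p $ 1 = q $ 1 \<and> p $ 2 = q $ 2 \<and> p $ (3 :: 3) = q $ 3"
  by (simp add: vec_eq_iff forall_3)

text \<open>For \<open>u \<noteq> 0\<close> the divided differences, multiplied by \<open>u\<close>, form a telescoping sum; for
  \<open>u = 0\<close> all of them are evaluated at the same argument \<open>x\<close>.\<close>

lemma shear_additive: "shear f q (s + t, p) = shear f q (s, shear f q (t, p))"
proof -
  define x a b where "x = p $ 1" and "a = t * poly q (p $ 2)" and "b = s * poly q (p $ 2)"
  let ?u = "p $ 2"
  have "(b + a) * poly (synthetic_div f x) (x + (b + a) * ?u)
      = a * poly (synthetic_div f x) (x + a * ?u)
        + b * poly (synthetic_div f (x + a * ?u)) (x + a * ?u + b * ?u)" (is "?l = ?r")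
  proof (cases "?u = 0")
    case True
    then show ?thesis by (simp add: algebra_simps)
  next
    case False
    have y: "x + (b + a) * ?u = x + a * ?u + b * ?u" by (simp add: algebra_simps)
    have l: "?u * ?l = poly f (x + a * ?u + b * ?u) - poly f x"
    proof -
      have "?u * ?l = (x + (b + a) * ?u - x) * poly (synthetic_div f x) (x + (b + a) * ?u)"
        by (simp add: algebra_simps)
      then show ?thesis by (simp only: poly_synthetic_div_diff y)
    qed
    have r: "?u * ?r = (poly f (x + a * ?u) - poly f x)
        + (poly f (x + a * ?u + b * ?u) - poly f (x + a * ?u))"
    proof -
      have "?u * ?r = (x + a * ?u - x) * poly (synthetic_div f x) (x + a * ?u)
          + (x + a * ?u + b * ?u - (x + a * ?u))
            * poly (synthetic_div f (x + a * ?u)) (x + a * ?u + b * ?u)"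
        by (simp add: algebra_simps)
      then show ?thesis by (simp only: poly_synthetic_div_diff)
    qed
    have "?u * ?l = ?u * ?r" unfolding l r by simp
    then show ?thesis using False by simp
  qed
  then show ?thesis
    by (simp add: vec3_eq_iff shear_nth x_def a_def b_def algebra_simps)
qed

lemma shear_on_surface:
  assumes "p \<in> surface f"
  shows "shear f q (t, p) \<in> surface f"
  using assms
    poly_synthetic_div_diff[of "p $ 1 + t * poly q (p $ 2) * p $ 2" "p $ 1" f]
  by (simp add: mem_surface shear_nth algebra_simps)

lemma effective_flow_shear:
  fixes f q :: "'k::field_char_0 poly"
  assumes "q \<noteq> 0"
  shows "effective_flow (surface f) (shear f q)"
  unfolding effective_flow_def
proof (intro conjI ballI allI impI shear_additive shear_on_surface)
  let ?P = "poly_funs coords_times :: ('k \<times> ('k ^ 3) \<Rightarrow> 'k) set"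
  have c: "fst \<in> ?P" "(\<lambda>z. snd z $ i) \<in> ?P" for i
    by (auto simp: coords_times_def intro: poly_funs.coord)
  have x: "(\<lambda>z. snd z $ 1 + fst z * poly q (snd z $ 2) * snd z $ 2) \<in> ?P"
    by (intro poly_funs.add poly_funs.mult poly_funs_poly c)
  have v: "(\<lambda>z. snd z $ 3 + fst z * poly q (snd z $ 2) *
      poly (synthetic_div f (snd z $ 1)) (snd z $ 1 + fst z * poly q (snd z $ 2) * snd z $ 2)) \<in> ?P"
    by (intro poly_funs.add poly_funs.mult poly_funs_poly poly_funs_synthetic_div c)
  fix i :: 3
  show "(\<lambda>z. shear f q z $ i) \<in> ?P"
    using exhaust_3[of i] x c(2)[of 2] v by (auto simp: shear_def case_prod_unfold)
next
  fix p
  show "shear f q (0, p) = p" by (simp add: vec3_eq_iff shear_nth)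
next
  fix t :: 'k assume t: "t \<noteq> 0"
  have "finite (insert 0 {u. poly q u = 0})" using poly_roots_finite[OF assms] by simp
  then obtain u where u: "u \<noteq> 0" "poly q u \<noteq> 0"
    using ex_new_if_finite[OF infinite_UNIV_char_0] by blast
  let ?p = "vector [0, u, poly f 0 / u] :: 'k ^ 3"
  have "?p \<in> surface f" using u by (simp add: mem_surface)
  moreover have "shear f q (t, ?p) \<noteq> ?p" using t u by (simp add: vec3_eq_iff shear_nth)
  ultimately show "\<exists>p\<in>surface f. shear f q (t, p) \<noteq> p" by blast
qed

definition swap_uv :: "'k::field_char_0 ^ 3 \<Rightarrow> 'k ^ 3" where
  "swap_uv p = vector [p $ 1, p $ 3, p $ 2]"

lemma swap_uv_nth [simp]:
  "swap_uv p $ 1 = p $ 1" "swap_uv p $ 2 = p $ 3" "swap_uv p $ 3 = p $ 2"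
  by (simp_all add: swap_uv_def)

lemma swap_uv_on_surface:
  "swap_uv p \<in> surface f \<longleftrightarrow> p \<in> surface f"
  by (simp add: mem_surface mult.commute)

lemma polynomially_inverse_swap_uv:
  "polynomially_inverse (surface f) swap_uv swap_uv"
proof -
  have "(\<lambda>p. swap_uv p $ i) \<in> poly_funs coords" for i
    using exhaust_3[of i] by (auto intro: poly_funs_coords_nth)
  then show ?thesis
    by (auto simp: polynomially_inverse_def poly_map_def swap_uv_on_surface vec3_eq_iff)
qed

definition coshear :: "'k::field_char_0 poly \<Rightarrow> 'k poly \<Rightarrow> 'k \<times> ('k ^ 3) \<Rightarrow> 'k ^ 3" where
  "coshear f q = (\<lambda>(t, p). swap_uv (shear f q (t, swap_uv p)))"

lemma effective_flow_coshear:
  assumes "q \<noteq> 0"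
  shows "effective_flow (surface f) (coshear f q)"
  unfolding coshear_def
  by (rule effective_flow_conjugate[OF effective_flow_shear[OF assms] polynomially_inverse_swap_uv])

lemma polynomial_interpolation:
  fixes y :: "'k::field \<Rightarrow> 'k"
  assumes "finite S"
  obtains q where "\<And>x. x \<in> S \<Longrightarrow> poly q x = y x"
proof -
  have "\<exists>q. \<forall>x\<in>S. poly q x = y x"
    using assms
  proof induction
    case (insert a S)
    then obtain q where q: "\<forall>x\<in>S. poly q x = y x" by blast
    \<comment> \<open>Newton's step: \<open>r\<close> vanishes on \<open>S\<close> and not at \<open>a\<close>.\<close>
    define r where "r = (\<Prod>b\<in>S. [:- b, 1:])"
    have r: "poly r x = (\<Prod>b\<in>S. x - b)" for x by (simp add: r_def poly_prod)
    have "poly r a \<noteq> 0" using insert.hyps by (auto simp: r)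
    moreover have "poly r x = 0" if "x \<in> S" for x using insert.hyps that by (auto simp: r)
    ultimately show ?case
      using q by (intro exI[of _ "q + smult ((y a - poly q a) / poly r a) r"]) auto
  qed simp
  then show ?thesis using that by blast
qed

text \<open>Interpolate \<open>q(u) = s(u) / u\<close> on \<open>U\<close> and take time \<open>1\<close>. If the interpolating polynomial is zero,
  so are all the shifts; any shear at time \<open>0\<close> then serves, whereas \<open>q = 0\<close> would not give an effective action.\<close>

lemma shear_prescribed_shifts:
  fixes f :: "'k::field_char_0 poly"
  assumes "finite U" "0 \<notin> U"
  obtains q t where "q \<noteq> 0" "\<And>p. p \<in> surface f \<Longrightarrow> p $ 2 \<in> U \<Longrightarrow>
    shear f q (t, p) = vector [p $ 1 + s (p $ 2), p $ 2, poly f (p $ 1 + s (p $ 2)) / p $ 2]"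
proof -
  obtain q where q: "\<And>u. u \<in> U \<Longrightarrow> poly q u = s u / u"
    using polynomial_interpolation[OF assms(1), of "\<lambda>u. s u / u"] by blast
  have *: "shear f q' (t, p) = vector [p $ 1 + s (p $ 2), p $ 2, poly f (p $ 1 + s (p $ 2)) / p $ 2]"
    if p: "p \<in> surface f" "p $ 2 \<in> U"
      and eq: "t * poly q' (p $ 2) = s (p $ 2) / p $ 2" for q' t p
  proof -
    have u: "p $ 2 \<noteq> 0" using p assms by auto
    have x: "shear f q' (t, p) $ 1 = p $ 1 + s (p $ 2)" using eq u by (simp add: shear_nth)
    have "poly f (shear f q' (t, p) $ 1) = p $ 2 * shear f q' (t, p) $ 3"
      using shear_on_surface[OF p(1), of q' t] by (simp add: mem_surface shear_nth)
    then show ?thesis using u x by (simp add: vec3_eq_iff shear_nth(2) field_simps)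
  qed
  show ?thesis
  proof (cases "q = 0")
    case True
    then have "s u / u = 0" if "u \<in> U" for u using q that by fastforce
    then show ?thesis using *[of _ 0 1] by (intro that[of 1 0]) auto
  next
    case False
    then show ?thesis using * q by (intro that[of q 1]) auto
  qed
qed

lemma SAut_shift_along_u:
  fixes f :: "'k::field_char_0 poly"
  assumes "finite U" "0 \<notin> U"
  obtains g where "g \<in> carrier (SAut (surface f))"
    "\<And>p. p \<in> surface f \<Longrightarrow> p $ 2 \<in> U \<Longrightarrow>
      g p = vector [p $ 1 + s (p $ 2), p $ 2, poly f (p $ 1 + s (p $ 2)) / p $ 2]"
proof -
  obtain q t where "q \<noteq> 0" "\<And>p. p \<in> surface f \<Longrightarrow> p $ 2 \<in> U \<Longrightarrow>
    shear f q (t, p) = vector [p $ 1 + s (p $ 2), p $ 2, poly f (p $ 1 + s (p $ 2)) / p $ 2]"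
    using shear_prescribed_shifts[OF assms] by metis
  then show ?thesis
    by (intro that[OF flow_in_SAut[OF effective_flow_shear, of q f t]]) auto
qed

lemma SAut_shift_along_v:
  fixes f :: "'k::field_char_0 poly"
  assumes "finite V" "0 \<notin> V"
  obtains g where "g \<in> carrier (SAut (surface f))"
    "\<And>p. p \<in> surface f \<Longrightarrow> p $ 3 \<in> V \<Longrightarrow>
      g p = vector [p $ 1 + s (p $ 3), poly f (p $ 1 + s (p $ 3)) / p $ 3, p $ 3]"
proof -
  obtain q t where q: "q \<noteq> 0" and *: "\<And>p. p \<in> surface f \<Longrightarrow> p $ 2 \<in> V \<Longrightarrow>
    shear f q (t, p) = vector [p $ 1 + s (p $ 2), p $ 2, poly f (p $ 1 + s (p $ 2)) / p $ 2]"
    using shear_prescribed_shifts[OF assms] by metis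
  show ?thesis
  proof (rule that[OF flow_in_SAut[OF effective_flow_coshear[OF q], of f t]])
    fix p assume "p \<in> surface f" "p $ 3 \<in> V"
    then show "restrict (\<lambda>p. coshear f q (t, p)) (surface f) p
        = vector [p $ 1 + s (p $ 3), poly f (p $ 1 + s (p $ 3)) / p $ 3, p $ 3]"
      using *[of "swap_uv p"] by (simp add: coshear_def swap_uv_on_surface vec3_eq_iff)
  qed
qed

lemma differential_suspension_eq:
  "differential (suspension_eq f) p w
     = poly (pderiv f) (p $ 1) * w $ 1 - p $ 3 * w $ 2 - p $ 2 * w $ 3"
  unfolding differential_def
  by (subst deriv0_eq[of _ "f \<circ>\<^sub>p [:p $ 1, w $ 1:] - [:p $ 2, w $ 2:] * [:p $ 3, w $ 3:]"])
    (simp_all add: suspension_eq_def poly_pcompose pderiv_diff pderiv_mult pderiv_pCons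
      pderiv_pcompose algebra_simps)

lemma smooth_points_suspension_eq:
  "p \<in> smooth_points (suspension_eq f) \<longleftrightarrow> p \<in> surface f \<and>
     (poly (pderiv f) (p $ 1) \<noteq> 0 \<or> p $ 2 \<noteq> 0 \<or> p $ 3 \<noteq> 0)"
proof -
  have "(\<exists>i. differential (suspension_eq f) p (axis i 1) \<noteq> 0) \<longleftrightarrow>
     \<not> (\<forall>i. differential (suspension_eq f) p (axis i 1) = 0)" by blast
  also have "\<dots> \<longleftrightarrow> (poly (pderiv f) (p $ 1) \<noteq> 0 \<or> p $ 2 \<noteq> 0 \<or> p $ 3 \<noteq> 0)"
    unfolding differential_suspension_eq by (auto simp: forall_3 axis_def)
  finally show ?thesis by (auto simp: smooth_points_def)
qed

lemma velocity_shear: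
  "velocity (\<lambda>t. shear f 1 (t, p)) = vector [p $ 2, 0, poly (pderiv f) (p $ 1)]"
proof -
  have "deriv0 (\<lambda>t. shear f 1 (t, p) $ 1) = p $ 2"
    by (subst deriv0_eq[of _ "[:p $ 1, p $ 2:]"]) (simp_all add: shear_nth pderiv_pCons)
  moreover have "deriv0 (\<lambda>t. shear f 1 (t, p) $ 2) = 0"
    by (subst deriv0_eq[of _ "[:p $ 2:]"]) (simp_all add: shear_nth pderiv_pCons)
  moreover have "deriv0 (\<lambda>t. shear f 1 (t, p) $ 3) = poly (pderiv f) (p $ 1)"
    by (subst deriv0_eq[of _ "[:p $ 3:] + [:0, 1:] * synthetic_div f (p $ 1) \<circ>\<^sub>p [:p $ 1, p $ 2:]"])
      (simp_all add: shear_nth pderiv_pCons pderiv_add pderiv_mult poly_pcompose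
        poly_synthetic_div_diagonal)
  ultimately show ?thesis by (simp add: velocity_def vec3_eq_iff)
qed

lemma velocity_coshear:
  "velocity (\<lambda>t. coshear f 1 (t, p)) = vector [p $ 3, poly (pderiv f) (p $ 1), 0]"
proof -
  have "velocity (\<lambda>t. coshear f 1 (t, p)) = swap_uv (velocity (\<lambda>t. shear f 1 (t, swap_uv p)))"
    by (simp add: vec3_eq_iff velocity_def coshear_def)
  then show ?thesis by (simp add: velocity_shear vec3_eq_iff)
qed

text \<open>The tangent vectors of the two standard flows are \<open>(u, 0, f'(x))\<close> and \<open>(v, f'(x), 0)\<close>. They span the
  tangent plane \<open>f'(x) w\<^sub>1 = v w\<^sub>2 + u w\<^sub>3\<close>, as the coefficients can be read off from the components
  \<open>w\<^sub>3\<close> and \<open>w\<^sub>2\<close>.\<close>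

lemma flexible_pointI_suspension:
  fixes f :: "'k::field_char_0 poly"
  assumes p: "p \<in> surface f" and f': "poly (pderiv f) (p $ 1) \<noteq> 0"
  shows "flexible_point (suspension_eq f) p"
proof (rule flexible_pointI[OF suspension_eq_poly_fun p], rule subsetI)
  let ?S = "{orbit_tangent \<phi> p |\<phi>. effective_Ga_action (surface f) \<phi>}"
  let ?a = "vector [p $ 2, 0, poly (pderiv f) (p $ 1)] :: 'k ^ 3"
  let ?b = "vector [p $ 3, poly (pderiv f) (p $ 1), 0] :: 'k ^ 3"
  have tangent: "velocity (\<lambda>t. \<Phi> (t, p)) \<in> ?S" if "effective_flow (surface f) \<Phi>" for \<Phi>
    using orbit_tangent_flow[OF p, of \<Phi>] that
    by (force simp: effective_Ga_action_iff)
  have "?a \<in> ?S"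
    using tangent[of "shear f 1"] effective_flow_shear[of 1 f] by (simp add: velocity_shear)
  moreover have "?b \<in> ?S"
    using tangent[of "coshear f 1"] effective_flow_coshear[of 1 f] by (simp add: velocity_coshear)
  ultimately have span: "a *s ?a + b *s ?b \<in> vec.span ?S" for a b
    by (intro vec.span_add vec.span_scale vec.span_base)
  fix w assume "w \<in> tangent_space (suspension_eq f) p"
  then have w: "poly (pderiv f) (p $ 1) * w $ 1 = p $ 3 * w $ 2 + p $ 2 * w $ 3"
    by (simp add: tangent_space_def differential_suspension_eq algebra_simps)
  let ?f' = "poly (pderiv f) (p $ 1)"
  have "w $ 1 = (p $ 3 * w $ 2 + p $ 2 * w $ 3) / ?f'"
    using w f' by (metis nonzero_mult_div_cancel_left)
  then have eq: "w = (w $ 3 / ?f') *s ?a + (w $ 2 / ?f') *s ?b"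
    using f' by (simp add: vec3_eq_iff add_divide_distrib mult.commute)
  show "w \<in> vec.span ?S" by (subst eq) (rule span)
qed

section \<open>Separation of points by shears\<close>

lemma finite_poly_shift_level:
  fixes f :: "'k::field_char_0 poly"
  assumes "0 < degree f"
  shows "finite {c. poly f (x + c) = a}"
proof -
  have "f \<circ>\<^sub>p [:x, 1:] - [:a:] \<noteq> 0"
  proof
    assume "f \<circ>\<^sub>p [:x, 1:] - [:a:] = 0"
    then have "f \<circ>\<^sub>p [:x, 1:] = [:a:]" by simp
    then have "degree (f \<circ>\<^sub>p [:x, 1:]) = 0" by simp
    then show False using assms by (simp add: degree_pcompose)
  qed
  from poly_roots_finite[OF this] show ?thesis by (simp add: poly_pcompose)
qed

text \<open>If \<open>f(x + c) = f(y + c)\<close> for all \<open>c\<close>, then \<open>x - y\<close> is a period of \<open>f\<close>. In characteristic zero it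
  has infinitely many multiples, and \<open>f\<close> takes the same value at all \<open>y + n (x - y)\<close>, so \<open>f\<close> is constant.\<close>

lemma finite_poly_shift_coincidence:
  fixes f :: "'k::field_char_0 poly"
  assumes "0 < degree f" "x \<noteq> y"
  shows "finite {c. poly f (x + c) = poly f (y + c)}"
proof -
  have "f \<circ>\<^sub>p [:x, 1:] - f \<circ>\<^sub>p [:y, 1:] \<noteq> 0"
  proof
    assume eq: "f \<circ>\<^sub>p [:x, 1:] - f \<circ>\<^sub>p [:y, 1:] = 0"
    have period: "poly f (x + c) = poly f (y + c)" for c
      using arg_cong[OF eq, of "\<lambda>p. poly p c"] by (simp add: poly_pcompose)
    have "poly f (y + of_nat n * (x - y)) = poly f y" for n
    proof (induction n)
      case (Suc n)
      then show ?case
        using period[of "of_nat n * (x - y)"] by (simp add: algebra_simps)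
    qed simp
    then have "range (\<lambda>n. of_nat n * (x - y)) \<subseteq> {c. poly f (y + c) = poly f y}" by auto
    moreover have "inj (\<lambda>n. of_nat n * (x - y))" using assms(2) by (simp add: inj_def)
    ultimately show False
      using finite_poly_shift_level[OF assms(1)] finite_subset range_inj_infinite by metis
  qed
  from poly_roots_finite[OF this] show ?thesis by (simp add: poly_pcompose)
qed

text \<open>The value \<open>f(x + s(u)) / u\<close> is the \<open>v\<close>-coordinate of the point \<open>(x, u)\<close> after the shift \<open>s\<close>. The
  shifts are chosen one \<open>u\<close> at a time, each avoiding the finitely many values that produce a zero, a
  coincidence with an earlier point, or a coincidence of two points with the current \<open>u\<close>.\<close>

lemma separating_shifts:
  fixes f :: "'k::field_char_0 poly"
  assumes f: "0 < degree f" and A: "finite A" and U: "finite U" "0 \<notin> U"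
  shows "\<exists>s. (\<forall>x\<in>A. \<forall>u\<in>U. poly f (x + s u) \<noteq> 0) \<and>
    inj_on (\<lambda>(x, u). poly f (x + s u) / u) (A \<times> U)"
  using U
proof induction
  case (insert u U)
  then obtain s where s: "\<forall>x\<in>A. \<forall>u\<in>U. poly f (x + s u) \<noteq> 0"
    "inj_on (\<lambda>(x, u). poly f (x + s u) / u) (A \<times> U)" by auto
  define B where "B = (\<Union>x\<in>A. {c. poly f (x + c) = 0})
    \<union> (\<Union>x\<in>A. \<Union>(y, w)\<in>A \<times> U. {c. poly f (x + c) = u * (poly f (y + s w) / w)})
    \<union> (\<Union>x\<in>A. \<Union>y\<in>A - {x}. {c. poly f (x + c) = poly f (y + c)})"
  have "finite B"
    unfolding B_def using A insert.hyps
    by (auto intro!: finite_poly_shift_level[OF f] finite_poly_shift_coincidence[OF f])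
  then obtain c where c: "c \<notin> B" using ex_new_if_finite[OF infinite_UNIV_char_0] by blast
  have u: "u \<noteq> 0" using insert.prems by auto
  let ?s = "s(u := c)"
  have new: "poly f (x + c) / u \<noteq> poly f (y + s w) / w" if "x \<in> A" "y \<in> A" "w \<in> U" for x y w
  proof -
    have "poly f (x + c) \<noteq> u * (poly f (y + s w) / w)" using c that unfolding B_def by blast
    then show ?thesis using u by (metis nonzero_eq_divide_eq mult.commute)
  qed
  have same: "poly f (x + c) / u \<noteq> poly f (y + c) / u" if "x \<in> A" "y \<in> A" "x \<noteq> y" for x y
    using c that u unfolding B_def by auto
  have "inj_on (\<lambda>(x, w). poly f (x + ?s w) / w) (A \<times> insert u U)"
  proof (rule inj_onI, clarify)
    fix x w y z
    assume in_A: "x \<in> A" "y \<in> A" and wz: "w \<in> insert u U" "z \<in> insert u U"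
      and eq: "poly f (x + ?s w) / w = poly f (y + ?s z) / z"
    consider "w = u" "z = u" | "w = u" "z \<in> U" "z \<noteq> u" | "w \<in> U" "w \<noteq> u" "z = u"
      | "w \<in> U" "w \<noteq> u" "z \<in> U" "z \<noteq> u" using wz by blast
    then show "x = y \<and> w = z"
    proof cases
      case 1
      then show ?thesis using eq same[OF in_A] by auto
    next
      case 2
      then show ?thesis using eq new[OF in_A(1,2), of z] by simp
    next
      case 3
      then show ?thesis using eq new[OF in_A(2,1), of w] by simp
    next
      case 4
      then show ?thesis using eq inj_onD[OF s(2), of "(x, w)" "(y, z)"] in_A by simp
    qed
  qed
  moreover have "\<forall>x\<in>A. \<forall>w\<in>insert u U. poly f (x + ?s w) \<noteq> 0"
    using s(1) c unfolding B_def by auto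
  ultimately show ?case by blast
qed (simp add: inj_on_def)

text \<open>The translation performed by a shear is a function of \<open>u\<close>; as the \<open>u\<close>-coordinates of the points
  are distinct, it may as well depend on the index of the point.\<close>

lemma prescribe_x_along_u:
  fixes m :: nat and y :: "nat \<Rightarrow> 'k::field_char_0"
  assumes P: "\<And>i. i < m \<Longrightarrow> P i \<in> surface f" and u: "\<And>i. i < m \<Longrightarrow> P i $ 2 \<noteq> 0"
    "inj_on (\<lambda>i. P i $ 2) {..<m}"
  obtains g where "g \<in> carrier (SAut (surface f))"
    "\<And>i. i < m \<Longrightarrow> g (P i) = vector [y i, P i $ 2, poly f (y i) / P i $ 2]"
proof -
  let ?U = "(\<lambda>i. P i $ 2) ` {..<m}"
  have U: "finite ?U" "0 \<notin> ?U" using u by auto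
  define idx where "idx = the_inv_into {..<m} (\<lambda>i. P i $ 2)"
  have idx: "idx (P i $ 2) = i" if "i < m" for i
    using the_inv_into_f_f[OF u(2)] that by (simp add: idx_def)
  obtain g where g: "g \<in> carrier (SAut (surface f))"
    "\<And>p. p \<in> surface f \<Longrightarrow> p $ 2 \<in> ?U \<Longrightarrow>
      g p = vector [p $ 1 + (y (idx (p $ 2)) - P (idx (p $ 2)) $ 1), p $ 2,
        poly f (p $ 1 + (y (idx (p $ 2)) - P (idx (p $ 2)) $ 1)) / p $ 2]"
    using SAut_shift_along_u[OF U, of f "\<lambda>w. y (idx w) - P (idx w) $ 1"] by blast
  show ?thesis by (rule that[OF g(1)]) (use g(2) P idx in simp)
qed

lemma prescribe_x_along_v:
  fixes m :: nat and y :: "nat \<Rightarrow> 'k::field_char_0"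
  assumes P: "\<And>i. i < m \<Longrightarrow> P i \<in> surface f" and v: "\<And>i. i < m \<Longrightarrow> P i $ 3 \<noteq> 0"
    "inj_on (\<lambda>i. P i $ 3) {..<m}"
  obtains g where "g \<in> carrier (SAut (surface f))"
    "\<And>i. i < m \<Longrightarrow> g (P i) = vector [y i, poly f (y i) / P i $ 3, P i $ 3]"
proof -
  let ?V = "(\<lambda>i. P i $ 3) ` {..<m}"
  have V: "finite ?V" "0 \<notin> ?V" using v by auto
  define idx where "idx = the_inv_into {..<m} (\<lambda>i. P i $ 3)"
  have idx: "idx (P i $ 3) = i" if "i < m" for i
    using the_inv_into_f_f[OF v(2)] that by (simp add: idx_def)
  obtain g where g: "g \<in> carrier (SAut (surface f))"
    "\<And>p. p \<in> surface f \<Longrightarrow> p $ 3 \<in> ?V \<Longrightarrow>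
      g p = vector [p $ 1 + (y (idx (p $ 3)) - P (idx (p $ 3)) $ 1),
        poly f (p $ 1 + (y (idx (p $ 3)) - P (idx (p $ 3)) $ 1)) / p $ 3, p $ 3]"
    using SAut_shift_along_v[OF V, of f "\<lambda>w. y (idx w) - P (idx w) $ 1"] by blast
  show ?thesis by (rule that[OF g(1)]) (use g(2) P idx in simp)
qed

text \<open>For each point only finitely many times \<open>t\<close> of the coshear with \<open>q = 1\<close> give \<open>u = 0\<close>: if
  \<open>v \<noteq> 0\<close>, these are the solutions of \<open>f(x + t v) = 0\<close>; if \<open>v = 0\<close>, then \<open>u\<close> becomes \<open>u + t f'(x)\<close>,
  and smoothness says that \<open>u\<close> and \<open>f'(x)\<close> are not both zero.\<close>

lemma make_u_nonzero:
  fixes f :: "'k::field_char_0 poly" and m :: nat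
  assumes f: "0 < degree f" and P: "\<And>i. i < m \<Longrightarrow> P i \<in> smooth_points (suspension_eq f)"
  obtains g where "g \<in> carrier (SAut (surface f))" "\<And>i. i < m \<Longrightarrow> g (P i) $ 2 \<noteq> 0"
proof -
  have bad: "finite {t. coshear f 1 (t, p) $ 2 = 0}"
    if p: "p \<in> smooth_points (suspension_eq f)" for p
  proof (cases "p $ 3 = 0")
    case False
    have "poly f (p $ 1 + t * p $ 3) = coshear f 1 (t, p) $ 2 * p $ 3" for t
    proof -
      have "p \<in> surface f" using p by (simp add: smooth_points_def)
      then have "coshear f 1 (t, p) \<in> surface f"
        using effective_flow_coshear[of 1 f] by (auto simp: effective_flow_def)
      then show ?thesis
        by (simp add: mem_surface coshear_def shear_nth)
    qed
    then have "{t. coshear f 1 (t, p) $ 2 = 0} = (\<lambda>t. t * p $ 3) -` {c. poly f (p $ 1 + c) = 0}"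
      using False by (auto simp: vimage_def)
    moreover have "inj (\<lambda>t. t * p $ 3)" using False by (simp add: inj_def)
    ultimately show ?thesis
      using finite_vimageI[OF finite_poly_shift_level[OF f]] by metis
  next
    case True
    have "coshear f 1 (t, p) $ 2 = p $ 2 + t * poly (pderiv f) (p $ 1)" for t
      using True by (simp add: coshear_def shear_nth poly_synthetic_div_diagonal)
    then have eq: "{t. coshear f 1 (t, p) $ 2 = 0} = {t. poly [:p $ 2, poly (pderiv f) (p $ 1):] t = 0}"
      by simp
    have "[:p $ 2, poly (pderiv f) (p $ 1):] \<noteq> 0"
      using p True by (auto simp: smooth_points_suspension_eq)
    then show ?thesis unfolding eq by (rule poly_roots_finite)
  qed
  then have "finite (\<Union>i<m. {t. coshear f 1 (t, P i) $ 2 = 0})" using P by blast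
  then obtain t where t: "t \<notin> (\<Union>i<m. {t. coshear f 1 (t, P i) $ 2 = 0})"
    using ex_new_if_finite[OF infinite_UNIV_char_0] by blast
  show ?thesis
  proof (rule that)
    show "restrict (\<lambda>p. coshear f 1 (t, p)) (surface f) \<in> carrier (SAut (surface f))"
      by (rule flow_in_SAut[OF effective_flow_coshear]) simp
    fix i assume "i < m"
    then show "restrict (\<lambda>p. coshear f 1 (t, p)) (surface f) (P i) $ 2 \<noteq> 0"
      using t P by (auto simp: smooth_points_def)
  qed
qed

text \<open>Where \<open>u \<noteq> 0\<close> the pair \<open>(x, u)\<close> determines the point, so distinct points give distinct pairs,
  and the separating translations apply to a rectangular grid that contains all of them.\<close>

lemma make_v_distinct:
  fixes f :: "'k::field_char_0 poly" and m :: nat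
  assumes f: "0 < degree f" and P: "\<And>i. i < m \<Longrightarrow> P i \<in> surface f" "inj_on P {..<m}"
    and u: "\<And>i. i < m \<Longrightarrow> P i $ 2 \<noteq> 0"
  obtains g where "g \<in> carrier (SAut (surface f))" "\<And>i. i < m \<Longrightarrow> g (P i) $ 3 \<noteq> 0"
    "inj_on (\<lambda>i. g (P i) $ 3) {..<m}"
proof -
  let ?A = "(\<lambda>i. P i $ 1) ` {..<m}" and ?U = "(\<lambda>i. P i $ 2) ` {..<m}"
  have U: "finite ?U" "0 \<notin> ?U" using u by auto
  obtain s where s: "\<forall>x\<in>?A. \<forall>u\<in>?U. poly f (x + s u) \<noteq> 0"
    "inj_on (\<lambda>(x, u). poly f (x + s u) / u) (?A \<times> ?U)"
    using separating_shifts[OF f _ U, of ?A] by auto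
  obtain g where g: "g \<in> carrier (SAut (surface f))"
    "\<And>p. p \<in> surface f \<Longrightarrow> p $ 2 \<in> ?U \<Longrightarrow>
      g p = vector [p $ 1 + s (p $ 2), p $ 2, poly f (p $ 1 + s (p $ 2)) / p $ 2]"
    using SAut_shift_along_u[OF U, of f s] by blast
  have v: "g (P i) $ 3 = poly f (P i $ 1 + s (P i $ 2)) / P i $ 2" if "i < m" for i
    using g(2)[of "P i"] P(1) that by simp
  show ?thesis
  proof (rule that[OF g(1)])
    show "g (P i) $ 3 \<noteq> 0" if "i < m" for i using v[OF that] s(1) u that by auto
    show "inj_on (\<lambda>i. g (P i) $ 3) {..<m}"
    proof (rule inj_onI)
      fix i j assume i: "i \<in> {..<m}" and j: "j \<in> {..<m}" and eq: "g (P i) $ 3 = g (P j) $ 3"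
      have "(P i $ 1, P i $ 2) = (P j $ 1, P j $ 2)"
        by (rule inj_onD[OF s(2)]) (use eq i j v in auto)
      moreover from this have "P i $ 3 = P j $ 3"
        using P(1)[of i] P(1)[of j] u[of i] i j by (auto simp: mem_surface)
      ultimately have "P i = P j" by (simp add: vec3_eq_iff)
      then show "i = j" using inj_onD[OF P(2)] i j by blast
    qed
  qed
qed

section \<open>Multiple transitivity and flexibility\<close>

lemma degree_pos_if_surj:
  fixes f :: "'k::field_char_0 poly"
  assumes f: "range (poly f) = UNIV"
  shows "0 < degree f"
proof (rule ccontr)
  assume "\<not> 0 < degree f"
  then obtain a where "f = [:a:]" using degree_eq_zeroE by blast
  then have "range (poly f) = {a}" by auto
  then have "(0 :: 'k) = a" "(1 :: 'k) = a" using f by blast+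
  then show False by simp
qed

lemma reduced_suspension_if_surj:
  assumes "range (poly f) = UNIV"
  shows "reduced_equation (suspension_eq f)"
  using degree_pos_if_surj[OF assms] by (intro reduced_suspension_eq) auto

text \<open>The target depends only on \<open>i\<close> and not on \<open>P\<close>. Its \<open>u\<close>-coordinates start at \<open>1\<close>, because they
  have to be nonzero for the last shear.\<close>

lemma move_to_standard_tuple:
  fixes f :: "'k::field_char_0 poly" and m :: nat
  assumes f: "range (poly f) = UNIV" and inj: "inj_on P {..<m}"
    and P: "\<And>i. i < m \<Longrightarrow> P i \<in> smooth_points (suspension_eq f)"
  shows "\<exists>g \<in> carrier (SAut (surface f)). \<forall>i<m.
    g (P i) = vector [0, of_nat (Suc i), poly f 0 / of_nat (Suc i)]"
proof -
  have PX: "P i \<in> surface f" if "i < m" for i using P[OF that] by (simp add: smooth_points_def)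
  obtain g1 where g1: "g1 \<in> carrier (SAut (surface f))" "\<And>i. i < m \<Longrightarrow> g1 (P i) $ 2 \<noteq> 0"
    using make_u_nonzero[OF degree_pos_if_surj[OF f], of m P] P by metis
  define P1 where "P1 i = g1 (P i)" for i
  have P1: "P1 i \<in> surface f" if "i < m" for i
    using SAut_mem[OF g1(1) PX[OF that]] by (simp add: P1_def)
  have "inj_on P1 {..<m}"
    using inj SAut_inj[OF g1(1) PX PX] by (auto simp: inj_on_def P1_def)
  moreover have "P1 i $ 2 \<noteq> 0" if "i < m" for i using g1(2)[OF that] by (simp add: P1_def)
  ultimately obtain g2 where g2: "g2 \<in> carrier (SAut (surface f))"
    "\<And>i. i < m \<Longrightarrow> g2 (P1 i) $ 3 \<noteq> 0"
    "inj_on (\<lambda>i. g2 (P1 i) $ 3) {..<m}"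
    using make_v_distinct[OF degree_pos_if_surj[OF f], of m P1] P1 by metis
  define P2 where "P2 i = g2 (P1 i)" for i
  have P2: "P2 i \<in> surface f" if "i < m" for i
    using SAut_mem[OF g2(1) P1[OF that]] by (simp add: P2_def)
  have v: "P2 i $ 3 \<noteq> 0" if "i < m" for i using g2(2)[OF that] by (simp add: P2_def)
  have v_inj: "inj_on (\<lambda>i. P2 i $ 3) {..<m}" using g2(3) by (simp add: P2_def)
  \<comment> \<open>Surjectivity of \<open>f\<close> enters here: after \<open>x\<close> is set to \<open>y i\<close>, the coordinate \<open>u = f(x) / v\<close> is \<open>i + 1\<close>.\<close>
  define y where "y i = (SOME x. poly f x = of_nat (Suc i) * P2 i $ 3)" for i
  have y: "poly f (y i) = of_nat (Suc i) * P2 i $ 3" for i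
  proof -
    have "\<exists>x. poly f x = of_nat (Suc i) * P2 i $ 3" using f by (metis surjD)
    then show ?thesis unfolding y_def by (rule someI_ex)
  qed
  obtain g3 where g3: "g3 \<in> carrier (SAut (surface f))"
    "\<And>i. i < m \<Longrightarrow> g3 (P2 i) = vector [y i, poly f (y i) / P2 i $ 3, P2 i $ 3]"
    using prescribe_x_along_v[of m P2 f y] P2 v v_inj by metis
  define P3 where "P3 i = g3 (P2 i)" for i
  have P3: "P3 i \<in> surface f" if "i < m" for i
    using SAut_mem[OF g3(1) P2[OF that]] by (simp add: P3_def)
  have u: "P3 i $ 2 = of_nat (Suc i)" if "i < m" for i
    using g3(2)[OF that] v[OF that] y[of i] by (simp add: P3_def)
  have "inj_on (\<lambda>i. P3 i $ 2) {..<m}" using u by (auto simp: inj_on_def simp del: of_nat_Suc)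
  moreover have "P3 i $ 2 \<noteq> 0" if "i < m" for i using u[OF that] by (simp del: of_nat_Suc)
  ultimately obtain g4 where g4: "g4 \<in> carrier (SAut (surface f))"
    "\<And>i. i < m \<Longrightarrow> g4 (P3 i) = vector [0, P3 i $ 2, poly f 0 / P3 i $ 2]"
    using prescribe_x_along_u[of m P3 f "\<lambda>_. 0"] P3 by metis
  obtain h1 where h1: "h1 \<in> carrier (SAut (surface f))" "\<And>p. p \<in> surface f \<Longrightarrow> h1 p = g2 (g1 p)"
    using SAut_compose[OF g2(1) g1(1)] by blast
  obtain h2 where h2: "h2 \<in> carrier (SAut (surface f))" "\<And>p. p \<in> surface f \<Longrightarrow> h2 p = g3 (h1 p)"
    using SAut_compose[OF g3(1) h1(1)] by blast
  obtain h3 where h3: "h3 \<in> carrier (SAut (surface f))" "\<And>p. p \<in> surface f \<Longrightarrow> h3 p = g4 (h2 p)"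
    using SAut_compose[OF g4(1) h2(1)] by blast
  have "h3 (P i) = vector [0, of_nat (Suc i), poly f 0 / of_nat (Suc i)]" if "i < m" for i
  proof -
    have "h3 (P i) = g4 (P3 i)"
      using h1(2) h2(2) h3(2) PX[OF that] by (simp add: P1_def P2_def P3_def)
    then show ?thesis using g4(2)[OF that] u[OF that] by simp
  qed
  then show ?thesis using h3(1) by blast
qed

lemma m_transitive_suspension:
  assumes f: "range (poly f) = UNIV"
  shows "m_transitive_action m (SAut (surface f)) (smooth_points (suspension_eq f))
     (\<lambda>g. restrict g (smooth_points (suspension_eq f)))"
  by (rule m_transitive_smooth_pointsI[OF reduced_suspension_if_surj[OF f]
        move_to_standard_tuple[OF f]])

text \<open>Spanning orbit tangents are known where \<open>f'(x) \<noteq> 0\<close>. The point \<open>(x, 1, f(x))\<close> with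
  \<open>f'(x) \<noteq> 0\<close> is of this kind, and transitivity moves it to any smooth point.\<close>

lemma flexible_suspension:
  fixes f :: "'k::field_char_0 poly"
  assumes f: "range (poly f) = UNIV"
  shows "flexible (suspension_eq f)"
  unfolding flexible_def
proof
  fix p assume p: "p \<in> smooth_points (suspension_eq f)"
  have "pderiv f \<noteq> 0" using degree_pos_if_surj[OF f] by (simp add: pderiv_eq_0_iff)
  then obtain x where x: "poly (pderiv f) x \<noteq> 0" using poly_all_0_iff_0 by blast
  let ?o = "vector [x, 1, poly f x] :: 'k ^ 3"
  have o: "?o \<in> surface f" by (simp add: mem_surface)
  then have "?o \<in> smooth_points (suspension_eq f)"
    by (simp add: smooth_points_suspension_eq)
  then obtain g where g: "g \<in> carrier (SAut (surface f))"
    "restrict g (smooth_points (suspension_eq f)) ?o = p"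
    using m_transitive_suspension[OF f, of 1, unfolded m_transitive_action_def,
        THEN conjunct2, rule_format, of "[?o]" "[p]"] p by auto
  obtain G H where G: "polynomially_inverse (surface f) G H" "g = restrict G (surface f)"
    using SAut_polynomially_inverse[OF g(1)] .
  have "flexible_point (suspension_eq f) ?o"
    using flexible_pointI_suspension[OF o] x by simp
  then have "flexible_point (suspension_eq f) (G ?o)"
    using flexible_point_image[OF reduced_suspension_if_surj[OF f] G(1)] o by simp
  moreover have "G ?o = p" using g(2) G(2) o \<open>?o \<in> smooth_points _\<close> by simp
  ultimately show "flexible_point (suspension_eq f) p" by simp
qed

theorem theorem3p1:
  fixes f :: "'k::field_char_0 poly"
  assumes "range (poly f) = UNIV"
  shows "flexible (suspension_eq f) \<and>
    (\<forall>m::nat. m_transitive_action m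
       (SAut (zero_locus (suspension_eq f)))
       (smooth_points (suspension_eq f))
       (\<lambda>g. restrict g (smooth_points (suspension_eq f))))"
  using flexible_suspension[OF assms] m_transitive_suspension[OF assms] by blast

end
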